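(* Let $p$ be a prime number and $m$ and $s$ positive integers such that $s$ divides $m$, $s\neq m$, and assume that $m$ and $m/s$ are even. Set $n= p^m -1$ and let $\mathcal{A}= \{a_0=0 < a_1 < \cdots < a_z\}$ be the set of minimal representatives of the family of minimal cyclotomic cosets (with respect to $n$ and $s$). Let $0 < \ell_2 <z$ be the index such that $a_{\ell_2} = p^{\frac{m}{2}}-1$, and consider an index $ 0 \leq \ell_1 < \ell_2$. Then there is a Steane enlargement of an EAQECC obtained from the BCH code $\mathbb{F}_{p^s}^n\cap C_{\Delta(\ell_2)}$ whose parameters are \[ \left[ \left [n, n - \frac{m}{s} (\ell_1 + \ell_2) -1 + \frac{m}{2s}, d'; \frac{m}{2s}+1 \right]\right]_{p^s}, \] where $d' \geq \min \left\{ a_{\ell_2 +1} +1, \left\lceil \left(\frac{p^s+1}{p^s} \right) (a_{\ell_1 +1} +1) \right\rceil \right\}$.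
   Context: Minimal cyclotomic cosets are $\mathcal{I}_a=\{ap^{\ell s}\bmod n:\ell\ge0\}$, $C_\Delta\subseteq\mathbb{F}_{p^m}^n$ is the code generated by the evaluations of $X^i$, $i\in\Delta$, at the $n$th roots of unity of $\mathbb{F}_{p^m}$, and $\Delta(\ell)=\bigcup_{\nu=0}^{\ell}\mathcal{I}_{a_\nu}$. The EAQECC of a code $C$ is the CSS-type entanglement-assisted code with $C_1=C_2=C$; its Steane enlargement for $C=\langle B_r\rangle\oplus\langle B_t\rangle$ is the EAQECC given by the symplectic code generated by $\begin{pmatrix}B_t & AB_t\\ B_r&0\\0&B_r\end{pmatrix}$, $A$ invertible without eigenvalues in the base field. *)

theory Defs
  imports Complex_Main "Jordan_Normal_Form.Char_Poly"
begin

text \<open>The base field F_q (q = p^s) is realised as the subfield {x. x^q = x}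
  of the ambient finite field F_{p^m} (a type 'a with CARD('a) = p^m).
  Vectors of length N are functions nat => 'a vanishing outside {0..<N}.\<close>

definition subfield_pow :: "nat \<Rightarrow> 'a::field set" where
  "subfield_pow q = {x. x ^ q = x}"

definition Fvecs :: "'a::field set \<Rightarrow> nat \<Rightarrow> (nat \<Rightarrow> 'a) set" where
  "Fvecs F N = {v. (\<forall>i<N. v i \<in> F) \<and> (\<forall>i\<ge>N. v i = 0)}"

definition rowspace :: "'a::field set \<Rightarrow> (nat \<Rightarrow> 'a) list \<Rightarrow> (nat \<Rightarrow> 'a) set" where
  "rowspace F vs = {v. \<exists>c. (\<forall>i<length vs. c i \<in> F) \<and>
                         v = (\<lambda>x. \<Sum>i<length vs. c i * (vs ! i) x)}"

definition lin_indep_rows :: "'a::field set \<Rightarrow> (nat \<Rightarrow> 'a) list \<Rightarrow> bool" where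
  "lin_indep_rows F vs \<longleftrightarrow> (\<forall>c. (\<forall>i<length vs. c i \<in> F) \<and>
       (\<lambda>x. \<Sum>i<length vs. c i * (vs ! i) x) = (\<lambda>x. 0) \<longrightarrow> (\<forall>i<length vs. c i = 0))"

definition dimF :: "'a::field set \<Rightarrow> (nat \<Rightarrow> 'a) set \<Rightarrow> nat" where
  "dimF F V = (LEAST k. \<exists>vs. length vs = k \<and> set vs \<subseteq> V \<and> rowspace F vs = V)"

definition symp :: "nat \<Rightarrow> (nat \<Rightarrow> 'a::field) \<Rightarrow> (nat \<Rightarrow> 'a) \<Rightarrow> 'a" where
  "symp n u v = (\<Sum>i<n. u i * v (n + i) - u (n + i) * v i)"

definition symp_dual :: "'a::field set \<Rightarrow> nat \<Rightarrow> (nat \<Rightarrow> 'a) set \<Rightarrow> (nat \<Rightarrow> 'a) set" where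
  "symp_dual F n S = {v \<in> Fvecs F (2 * n). \<forall>u\<in>S. symp n u v = 0}"

definition swt :: "nat \<Rightarrow> (nat \<Rightarrow> 'a::zero) \<Rightarrow> nat" where
  "swt n v = card {i. i < n \<and> (v i \<noteq> 0 \<or> v (n + i) \<noteq> 0)}"

text \<open>EAQECC attached to a linear code S in F_q^{2n}:
  [[n, n - dim S + c, d; c]] with c = (dim S - dim (S \<inter> S^{perp_s}))/2 and
  d = minimum symplectic weight of S^{perp_s} \ (S \<inter> S^{perp_s}).\<close>
definition ea_c :: "'a::field set \<Rightarrow> nat \<Rightarrow> (nat \<Rightarrow> 'a) set \<Rightarrow> nat" where
  "ea_c F n S = (dimF F S - dimF F (S \<inter> symp_dual F n S)) div 2"

definition ea_k :: "'a::field set \<Rightarrow> nat \<Rightarrow> (nat \<Rightarrow> 'a) set \<Rightarrow> int" where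
  "ea_k F n S = int n - int (dimF F S) + int (ea_c F n S)"

definition ea_d :: "'a::field set \<Rightarrow> nat \<Rightarrow> (nat \<Rightarrow> 'a) set \<Rightarrow> nat" where
  "ea_d F n S = Inf (swt n ` (symp_dual F n S - (S \<inter> symp_dual F n S)))"

definition steane_data ::
  "'a::field set \<Rightarrow> nat \<Rightarrow> (nat \<Rightarrow> 'a) set \<Rightarrow> (nat \<Rightarrow> 'a) list \<Rightarrow> (nat \<Rightarrow> 'a) list \<Rightarrow> 'a mat \<Rightarrow> bool" where
  "steane_data F n C rs ts A \<longleftrightarrow>
     set rs \<subseteq> Fvecs F n \<and> set ts \<subseteq> Fvecs F n \<and>
     lin_indep_rows F rs \<and> lin_indep_rows F ts \<and>
     {(\<lambda>x. u x + v x) | u v. u \<in> rowspace F rs \<and> v \<in> rowspace F ts} = C \<and>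
     rowspace F rs \<inter> rowspace F ts = {(\<lambda>x. 0)} \<and>
     A \<in> carrier_mat (length ts) (length ts) \<and>
     (\<forall>i<length ts. \<forall>j<length ts. A $$ (i, j) \<in> F) \<and>
     invertible_mat A \<and> (\<forall>e\<in>F. \<not> eigenvalue A e)"

text \<open>Rows of the matrix  (B_t | A B_t ; B_r | 0 ; 0 | B_r).\<close>
definition steane_rows ::
  "nat \<Rightarrow> (nat \<Rightarrow> 'a::field) list \<Rightarrow> (nat \<Rightarrow> 'a) list \<Rightarrow> 'a mat \<Rightarrow> (nat \<Rightarrow> 'a) list" where
  "steane_rows n rs ts A =
     map (\<lambda>i. (\<lambda>x. if x < n then (ts ! i) x
                   else (\<Sum>j<length ts. A $$ (i, j) * (ts ! j) (x - n)))) [0..<length ts]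
     @ map (\<lambda>r. (\<lambda>x. if x < n then r x else 0)) rs
     @ map (\<lambda>r. (\<lambda>x. if x < n then 0 else r (x - n))) rs"

definition steane_code ::
  "'a::field set \<Rightarrow> nat \<Rightarrow> (nat \<Rightarrow> 'a) list \<Rightarrow> (nat \<Rightarrow> 'a) list \<Rightarrow> 'a mat \<Rightarrow> (nat \<Rightarrow> 'a) set" where
  "steane_code F n rs ts A = rowspace F (steane_rows n rs ts A)"

definition cyc_coset :: "nat \<Rightarrow> nat \<Rightarrow> nat \<Rightarrow> nat \<Rightarrow> nat set" where
  "cyc_coset p s n a = {a * p ^ (l * s) mod n | l. True}"

definition min_reps :: "nat \<Rightarrow> nat \<Rightarrow> nat \<Rightarrow> nat set" where
  "min_reps p s n = {a. a < n \<and> (\<forall>b\<in>cyc_coset p s n a. a \<le> b)}"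

definition rep :: "nat \<Rightarrow> nat \<Rightarrow> nat \<Rightarrow> nat \<Rightarrow> nat" where
  "rep p s n i = sorted_list_of_set (min_reps p s n) ! i"

definition Delta :: "nat \<Rightarrow> nat \<Rightarrow> nat \<Rightarrow> nat \<Rightarrow> nat set" where
  "Delta p s n l = (\<Union>\<nu>\<in>{..l}. cyc_coset p s n (rep p s n \<nu>))"

text \<open>C_Delta: the 'a-span of the evaluation vectors of X^i, i in Delta, at the
  n-th roots of unity beta 0, ..., beta (n-1).\<close>
definition eval_code :: "(nat \<Rightarrow> 'a::field) \<Rightarrow> nat \<Rightarrow> nat set \<Rightarrow> (nat \<Rightarrow> 'a) set" where
  "eval_code \<beta> n \<Delta> = {v. \<exists>c. v = (\<lambda>j. if j < n then (\<Sum>i\<in>\<Delta>. c i * \<beta> j ^ i) else 0)}"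

end

theory Submission
  imports Defs "HOL-Number_Theory.Cong"
begin

text \<open>
  Write \<open>q = p ^ s\<close>, \<open>r = m div s\<close>, \<open>Q = q ^ (r div 2)\<close>, and let \<open>F\<close> be the field of
  order \<open>q\<close>. The subfield subcode is spanned by the words \<open>tr (x * \<beta> j ^ a)\<close>, one copy of the big
  field for each representative \<open>a > 0\<close>, plus the constants. The matrix \<open>A\<close> is multiplication of
  these parameters \<open>x\<close> by a fixed \<open>omega\<close> with \<open>omega ^ Q \<noteq> omega\<close>; as \<open>omega \<notin> F\<close>, it has no
  eigenvalue in \<open>F\<close>. Since \<open>u \<mapsto> (\<Sum>j. u j * \<beta> j ^ i)\<close> computes inner products with trace words,
  a pair \<open>(u, v)\<close> is symplectically orthogonal to the enlarged code iff the transforms of \<open>u\<close> and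
  \<open>v\<close> vanish at the first \<open>l1 + 1\<close> representatives and that of \<open>v\<close> is \<open>omega\<close> times that of
  \<open>u\<close> at the next ones. The only opposite exponents among the first \<open>l2 + 1\<close> cosets lie in those
  of \<open>0\<close> and of \<open>Q - 1\<close>, so the hull loses exactly the two constants and the \<open>r\<close> dimensions of the
  last coset: this is \<open>2 c = r + 2\<close>.

  For the distance, if \<open>u\<close> and \<open>v\<close> are proportional over \<open>F\<close>, then \<open>omega \<notin> F\<close> forces both into
  the dual of the large BCH code. Otherwise all \<open>q + 1\<close> projective combinations of \<open>u\<close> and \<open>v\<close> are
  nonzero words of the dual of the small one, and each position of the support of \<open>(u, v)\<close> is in the
  support of exactly \<open>q\<close> of them.
\<close>

section \<open>Codes over a subset that is a subfield\<close>

lemma sum_lessThan_add: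
  fixes g :: "nat \<Rightarrow> 'b::comm_monoid_add"
  shows "(\<Sum>i<a+b. g i) = (\<Sum>i<a. g i) + (\<Sum>i<b. g (a+i))"
  by (induction b) (auto simp: add.assoc)

text \<open>Generator rows are listed in \<open>L\<close> blocks of \<open>r\<close>, so sums over
  rows will be read as double sums over blocks and positions.\<close>

lemma sum_div_mod:
  fixes g :: "nat \<Rightarrow> nat \<Rightarrow> 'b::comm_monoid_add"
  assumes "0 < r"
  shows "(\<Sum>i<L*r. g (i div r) (i mod r)) = (\<Sum>\<nu><L. \<Sum>k<r. g \<nu> k)"
proof (induction L)
  case (Suc L)
  have "(\<Sum>i<Suc L*r. g (i div r) (i mod r))
      = (\<Sum>i<L*r. g (i div r) (i mod r)) + (\<Sum>i<r. g ((L*r+i) div r) ((L*r+i) mod r))"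
    by (simp add: add.commute[of r] sum_lessThan_add)
  also have "(\<Sum>i<r. g ((L*r+i) div r) ((L*r+i) mod r)) = (\<Sum>k<r. g L k)"
    by (rule sum.cong) auto
  finally show ?case using Suc by simp
qed simp

lemma rowspaceI:
  "\<forall>i<length vs. c i \<in> F \<Longrightarrow> (\<lambda>x. \<Sum>i<length vs. c i * (vs ! i) x) \<in> rowspace F vs"
  by (auto simp: rowspace_def)

lemma lin_indep_rowsD:
  assumes "lin_indep_rows F vs" "\<forall>i<length vs. c i \<in> F"
    and "(\<lambda>x. \<Sum>i<length vs. c i * (vs ! i) x) = (\<lambda>x. 0)" "i < length vs"
  shows "c i = 0"
  using assms unfolding lin_indep_rows_def by blast

lemma rowspace_append:
  "rowspace F (xs @ ys) = {(\<lambda>x. u x + v x) | u v. u \<in> rowspace F xs \<and> v \<in> rowspace F ys}"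
proof (intro equalityI subsetI)
  fix w assume "w \<in> rowspace F (xs @ ys)"
  then obtain c where c: "\<forall>i<length xs + length ys. c i \<in> F"
    and w: "w = (\<lambda>x. \<Sum>i<length xs + length ys. c i * ((xs @ ys) ! i) x)"
    by (auto simp: rowspace_def)
  let ?u = "\<lambda>x. \<Sum>i<length xs. c i * (xs ! i) x"
  let ?v = "\<lambda>x. \<Sum>i<length ys. c (length xs + i) * (ys ! i) x"
  have "w = (\<lambda>x. ?u x + ?v x)"
    unfolding w sum_lessThan_add by (simp add: nth_append)
  moreover have "?u \<in> rowspace F xs" using c by (intro rowspaceI) auto
  moreover have "?v \<in> rowspace F ys"
    using c by (intro rowspaceI) auto
  ultimately show "w \<in> {(\<lambda>x. u x + v x) | u v. u \<in> rowspace F xs \<and> v \<in> rowspace F ys}"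
    by (intro CollectI exI[of _ ?u] exI[of _ ?v] conjI)
next
  fix w assume "w \<in> {(\<lambda>x. u x + v x) | u v. u \<in> rowspace F xs \<and> v \<in> rowspace F ys}"
  then obtain c d where c: "\<forall>i<length xs. c i \<in> F" and d: "\<forall>i<length ys. d i \<in> F"
    and w: "w = (\<lambda>x. (\<Sum>i<length xs. c i * (xs ! i) x) + (\<Sum>i<length ys. d i * (ys ! i) x))"
    by (auto simp: rowspace_def)
  let ?e = "\<lambda>i. if i < length xs then c i else d (i - length xs)"
  have "w = (\<lambda>x. \<Sum>i<length xs + length ys. ?e i * ((xs @ ys) ! i) x)"
    unfolding w sum_lessThan_add by (simp add: nth_append)
  moreover have "\<forall>i<length xs + length ys. ?e i \<in> F" using c d by auto
  ultimately show "w \<in> rowspace F (xs @ ys)"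
    unfolding rowspace_def by (auto intro!: exI[of _ ?e])
qed

lemma rowspace_map_linear:
  assumes "\<And>c. g (\<lambda>x. \<Sum>i<length xs. c i * (xs ! i) x) = (\<lambda>x. \<Sum>i<length xs. c i * h (xs ! i) x)"
  shows "rowspace F (map h xs) = g ` rowspace F xs"
proof -
  have *: "(\<lambda>x. \<Sum>i<length (map h xs). c i * (map h xs ! i) x)
      = g (\<lambda>x. \<Sum>i<length xs. c i * (xs ! i) x)" for c
    using assms[of c] by simp
  show ?thesis unfolding rowspace_def * by auto
qed

text \<open>The small field is a set inside the ambient type because entries of words over it get
  multiplied by elements of the large field. As \<open>inverse 0 = 0\<close>, closure under inverses
  needs no exception.\<close>

locale subfield_set =
  fixes F :: "'a::{field,finite} set"
  assumes zero_mem: "0 \<in> F" and one_mem: "1 \<in> F"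
    and add_mem: "x \<in> F \<Longrightarrow> y \<in> F \<Longrightarrow> x + y \<in> F"
    and minus_mem: "x \<in> F \<Longrightarrow> - x \<in> F"
    and mult_mem: "x \<in> F \<Longrightarrow> y \<in> F \<Longrightarrow> x * y \<in> F"
    and inverse_mem: "x \<in> F \<Longrightarrow> inverse x \<in> F"
begin

lemma diff_mem: "x \<in> F \<Longrightarrow> y \<in> F \<Longrightarrow> x - y \<in> F"
  using add_mem[of x "- y"] minus_mem[of y] by simp

lemma divide_mem: "x \<in> F \<Longrightarrow> y \<in> F \<Longrightarrow> x / y \<in> F"
  by (simp add: divide_inverse mult_mem inverse_mem)

lemma sum_mem: "(\<And>i. i \<in> I \<Longrightarrow> g i \<in> F) \<Longrightarrow> sum g I \<in> F"
  by (induction I rule: infinite_finite_induct) (auto simp: zero_mem add_mem)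

lemma card_gt_1: "1 < card F"
proof -
  have "card {0, 1 :: 'a} \<le> card F" by (rule card_mono) (auto simp: zero_mem one_mem)
  then show ?thesis by simp
qed

lemma row_in_rowspace: "v \<in> set vs \<Longrightarrow> v \<in> rowspace F vs"
proof -
  assume "v \<in> set vs"
  then obtain j where j: "j < length vs" "v = vs ! j" by (auto simp: in_set_conv_nth)
  have "v = (\<lambda>x. \<Sum>i<length vs. (if i = j then 1 else 0) * (vs ! i) x)"
    using j by (auto simp: if_distrib[of "\<lambda>y. y * _"] cong: if_cong)
  then show ?thesis unfolding rowspace_def
    using zero_mem one_mem by (auto intro!: exI[of _ "\<lambda>i. if i = j then 1 else 0"])
qed

lemma zero_in_rowspace: "(\<lambda>x. 0) \<in> rowspace F vs"
  unfolding rowspace_def using zero_mem by (auto intro!: exI[of _ "\<lambda>i. 0"])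

lemma rowspace_minus:
  assumes "u \<in> rowspace F vs"
  shows "(\<lambda>x. - u x) \<in> rowspace F vs"
proof -
  obtain c where "\<forall>i<length vs. c i \<in> F" "u = (\<lambda>x. \<Sum>i<length vs. c i * (vs ! i) x)"
    using assms by (auto simp: rowspace_def)
  then show ?thesis unfolding rowspace_def
    by (auto intro!: exI[of _ "\<lambda>i. - c i"] simp: minus_mem sum_negf)
qed

lemma rowspace_subset_Fvecs:
  assumes "set vs \<subseteq> Fvecs F N"
  shows "rowspace F vs \<subseteq> Fvecs F N"
proof
  fix v assume "v \<in> rowspace F vs"
  then obtain c where c: "\<forall>i<length vs. c i \<in> F" "v = (\<lambda>x. \<Sum>i<length vs. c i * (vs ! i) x)"
    by (auto simp: rowspace_def)
  have "vs ! i \<in> Fvecs F N" if "i < length vs" for i using assms that by auto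
  then show "v \<in> Fvecs F N" unfolding c(2) Fvecs_def
    using c(1) by (auto intro!: sum_mem mult_mem sum.neutral simp: Fvecs_def)
qed

text \<open>Coefficient functions are arbitrary beyond \<open>length vs\<close>; the extensional
  ones form a finite parameter set, so that words can be counted.\<close>

lemma rowspace_eq_image:
  "rowspace F vs = (\<lambda>c x. \<Sum>i<length vs. c i * (vs ! i) x) ` PiE {..<length vs} (\<lambda>_. F)"
proof (intro equalityI subsetI)
  fix v assume "v \<in> rowspace F vs"
  then obtain c where c: "\<forall>i<length vs. c i \<in> F" "v = (\<lambda>x. \<Sum>i<length vs. c i * (vs ! i) x)"
    by (auto simp: rowspace_def)
  have "v = (\<lambda>x. \<Sum>i<length vs. restrict c {..<length vs} i * (vs ! i) x)"
    unfolding c(2) by simp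
  moreover have "restrict c {..<length vs} \<in> PiE {..<length vs} (\<lambda>_. F)"
    using c(1) by auto
  ultimately show "v \<in> (\<lambda>c x. \<Sum>i<length vs. c i * (vs ! i) x) ` PiE {..<length vs} (\<lambda>_. F)"
    by blast
qed (auto simp: rowspace_def PiE_def Pi_def)

lemma finite_coeffs: "finite (PiE {..<(k::nat)} (\<lambda>_. F))"
  by (intro finite_PiE) auto

lemma card_rowspace_le: "card (rowspace F vs) \<le> card F ^ length vs"
proof -
  have "card (rowspace F vs) \<le> card (PiE {..<length vs} (\<lambda>_. F))"
    unfolding rowspace_eq_image by (rule card_image_le[OF finite_coeffs])
  then show ?thesis by (simp add: card_PiE)
qed

lemma card_rowspace:
  assumes "lin_indep_rows F vs"
  shows "card (rowspace F vs) = card F ^ length vs"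
proof -
  have "inj_on (\<lambda>c x. \<Sum>i<length vs. c i * (vs ! i) x) (PiE {..<length vs} (\<lambda>_. F))"
  proof (rule inj_onI)
    fix c d assume c: "c \<in> PiE {..<length vs} (\<lambda>_. F)" and d: "d \<in> PiE {..<length vs} (\<lambda>_. F)"
      and eq: "(\<lambda>x. \<Sum>i<length vs. c i * (vs ! i) x) = (\<lambda>x. \<Sum>i<length vs. d i * (vs ! i) x)"
    have "(\<lambda>x. \<Sum>i<length vs. (c i - d i) * (vs ! i) x) = (\<lambda>x. 0)"
      using fun_cong[OF eq] by (auto simp: algebra_simps sum_subtractf)
    moreover have "\<forall>i<length vs. c i - d i \<in> F" using c d by (auto intro!: diff_mem)
    ultimately have "\<forall>i<length vs. c i - d i = 0"
      using lin_indep_rowsD[OF assms, of "\<lambda>i. c i - d i"] by blast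
    then show "c = d" using c d by (intro PiE_ext[of c _ _ d]) auto
  qed
  then show ?thesis unfolding rowspace_eq_image by (simp add: card_image card_PiE)
qed

text \<open>Counting replaces the exchange of bases: \<open>k\<close> generators yield at most
  \<open>card F ^ k\<close> words, and independent rows attain this bound.\<close>

lemma dimF_rowspace:
  assumes "lin_indep_rows F vs"
  shows "dimF F (rowspace F vs) = length vs"
  unfolding dimF_def
proof (rule Least_equality)
  show "\<exists>ws. length ws = length vs \<and> set ws \<subseteq> rowspace F vs \<and> rowspace F ws = rowspace F vs"
    using row_in_rowspace by blast
next
  fix k assume "\<exists>ws. length ws = k \<and> set ws \<subseteq> rowspace F vs \<and> rowspace F ws = rowspace F vs"
  then obtain ws where "length ws = k" "rowspace F ws = rowspace F vs" by blast
  with card_rowspace[OF assms] card_rowspace_le[of ws]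
  have "card F ^ length vs \<le> card F ^ k" by simp
  then show "length vs \<le> k" using card_gt_1 by simp
qed

lemma lin_indep_append:
  assumes xs: "lin_indep_rows F xs" and ys: "lin_indep_rows F ys"
    and int: "rowspace F xs \<inter> rowspace F ys \<subseteq> {\<lambda>x. 0}"
  shows "lin_indep_rows F (xs @ ys)"
  unfolding lin_indep_rows_def
proof (intro allI impI)
  fix c i assume c: "(\<forall>i<length (xs @ ys). c i \<in> F) \<and>
    (\<lambda>x. \<Sum>i<length (xs @ ys). c i * ((xs @ ys) ! i) x) = (\<lambda>x. 0)" and i: "i < length (xs @ ys)"
  let ?u = "\<lambda>x. \<Sum>i<length xs. c i * (xs ! i) x"
  let ?v = "\<lambda>x. \<Sum>i<length ys. c (length xs + i) * (ys ! i) x"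
  have "(\<lambda>x. ?u x + ?v x) = (\<lambda>x. 0)"
    using conjunct2[OF c] by (simp add: sum_lessThan_add nth_append)
  then have uv: "?u = (\<lambda>x. - ?v x)" by (auto simp: fun_eq_iff eq_neg_iff_add_eq_0)
  have u: "?u \<in> rowspace F xs" using c by (intro rowspaceI) auto
  have v: "?v \<in> rowspace F ys"
    using c by (intro rowspaceI) auto
  have "?u \<in> rowspace F ys" using rowspace_minus[OF v] uv by metis
  with u int have u0: "?u = (\<lambda>x. 0)" by blast
  with uv have v0: "?v = (\<lambda>x. 0)" by (auto simp: fun_eq_iff)
  have "\<forall>i<length xs. c i = 0"
    using lin_indep_rowsD[OF xs _ u0] c by auto
  moreover have "\<forall>i<length ys. c (length xs + i) = 0"
    using lin_indep_rowsD[OF ys _ v0] c by auto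
  ultimately show "c i = 0" using i
    by (cases "i < length xs") (auto dest!: spec[of _ "i - length xs"])
qed

end

section \<open>Pairs of words and the rows of a Steane enlargement\<close>

definition pairv :: "nat \<Rightarrow> (nat \<Rightarrow> 'a) \<Rightarrow> (nat \<Rightarrow> 'a) \<Rightarrow> nat \<Rightarrow> 'a" where
  "pairv n u v = (\<lambda>x. if x < n then u x else v (x - n))"

lemma pairv_eqD2: "pairv n u v = pairv n u' v' \<Longrightarrow> v = v'"
proof
  fix x assume "pairv n u v = pairv n u' v'"
  then show "v x = v' x" using fun_cong[of _ _ "n + x"] by (fastforce simp: pairv_def)
qed

text \<open>\<open>pairv\<close> cuts off only its first argument at \<open>n\<close>, hence the
  vanishing conditions here and none in \<open>pairv_eqD2\<close>.\<close>

lemma pairv_eqD1: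
  assumes "pairv n u v = pairv n u' v'" "\<forall>x\<ge>n. u x = 0" "\<forall>x\<ge>n. u' x = 0"
  shows "u = u'"
proof
  fix x show "u x = u' x"
    using fun_cong[OF assms(1), of x] assms(2,3) by (cases "x < n") (auto simp: pairv_def)
qed

lemma pairv_zero: "pairv n (\<lambda>x. 0) (\<lambda>x. 0) = (\<lambda>x. 0)"
  by (auto simp: pairv_def)

lemma pairv_in_Fvecs:
  assumes "u \<in> Fvecs F n" "v \<in> Fvecs F n"
  shows "pairv n u v \<in> Fvecs F (2 * n)"
  using assms unfolding Fvecs_def pairv_def by auto

lemma Fvecs_pairE:
  assumes "z \<in> Fvecs F (2 * n)"
  obtains u v where "u \<in> Fvecs F n" "v \<in> Fvecs F n" "z = pairv n u v"
proof
  show "(\<lambda>x. if x < n then z x else 0) \<in> Fvecs F n" using assms by (auto simp: Fvecs_def)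
  show "(\<lambda>x. z (n + x)) \<in> Fvecs F n" using assms by (auto simp: Fvecs_def)
qed (auto simp: pairv_def)

definition steane_top :: "nat \<Rightarrow> (nat \<Rightarrow> 'a::field) list \<Rightarrow> 'a mat \<Rightarrow> (nat \<Rightarrow> 'a) list" where
  "steane_top n ts A =
     map (\<lambda>i. pairv n (ts ! i) (\<lambda>x. \<Sum>j<length ts. A $$ (i, j) * (ts ! j) x)) [0..<length ts]"

lemma steane_rows_eq:
  "steane_rows n rs ts A = steane_top n ts A
     @ map (\<lambda>r. pairv n r (\<lambda>x. 0)) rs @ map (\<lambda>r. pairv n (\<lambda>x. 0) r) rs"
  by (simp add: steane_rows_def steane_top_def pairv_def)

lemma comb_pairv:
  fixes u v :: "nat \<Rightarrow> nat \<Rightarrow> 'a::field"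
  shows "(\<lambda>x. \<Sum>i<k. c i * pairv n (u i) (v i) x)
    = pairv n (\<lambda>x. \<Sum>i<k. c i * u i x) (\<lambda>x. \<Sum>i<k. c i * v i x)"
  by (auto simp: pairv_def fun_eq_iff)

lemma rowspace_left: "rowspace F (map (\<lambda>r. pairv n r (\<lambda>x. 0)) rs) = (\<lambda>r. pairv n r (\<lambda>x. 0)) ` rowspace F rs"
  by (rule rowspace_map_linear) (auto simp: pairv_def)

lemma rowspace_right: "rowspace F (map (\<lambda>r. pairv n (\<lambda>x. 0) r) rs) = (\<lambda>r. pairv n (\<lambda>x. 0) r) ` rowspace F rs"
  by (rule rowspace_map_linear) (auto simp: pairv_def)

lemma steane_top_comb:
  "(\<lambda>x. \<Sum>i<length (steane_top n ts A). c i * (steane_top n ts A ! i) x)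
   = pairv n (\<lambda>x. \<Sum>i<length ts. c i * (ts ! i) x)
       (\<lambda>x. \<Sum>i<length ts. c i * (\<Sum>j<length ts. A $$ (i, j) * (ts ! j) x))"
  by (auto simp: steane_top_def pairv_def)

lemma rowspace_steane_top:
  "rowspace F (steane_top n ts A) =
   {pairv n (\<lambda>x. \<Sum>i<length ts. c i * (ts ! i) x)
       (\<lambda>x. \<Sum>i<length ts. c i * (\<Sum>j<length ts. A $$ (i, j) * (ts ! j) x)) | c.
      \<forall>i<length ts. c i \<in> F}"
  unfolding rowspace_def steane_top_comb by (auto simp: steane_top_def)

text \<open>\<open>A\<close> couples the two halves over \<open>ts\<close>, whereas the two copies
  of \<open>rs\<close> are added independently. The description of the enlargement by trace
  parameters starts from this form.\<close>

lemma steane_code_eq: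
  fixes F :: "'a::field set"
  shows "steane_code F n rs ts A =
   {pairv n (\<lambda>x. (\<Sum>i<length ts. c i * (ts ! i) x) + \<rho> x)
       (\<lambda>x. (\<Sum>i<length ts. c i * (\<Sum>j<length ts. A $$ (i, j) * (ts ! j) x)) + \<rho>' x) | c \<rho> \<rho>'.
      (\<forall>i<length ts. c i \<in> F) \<and> \<rho> \<in> rowspace F rs \<and> \<rho>' \<in> rowspace F rs}"
  (is "_ = ?R")
proof -
  have *: "(\<lambda>x. pairv n a b x + (pairv n \<rho> (\<lambda>x. 0) x + pairv n (\<lambda>x. 0) \<rho>' x))
     = pairv n (\<lambda>x. a x + \<rho> x) (\<lambda>x. b x + \<rho>' x)" for a b \<rho> \<rho>' :: "nat \<Rightarrow> 'a"
    by (auto simp: pairv_def fun_eq_iff)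
  show ?thesis
  proof (intro equalityI subsetI)
    fix z assume "z \<in> steane_code F n rs ts A"
    then obtain c \<rho> \<rho>' where c: "\<forall>i<length ts. c i \<in> F" "\<rho> \<in> rowspace F rs" "\<rho>' \<in> rowspace F rs"
      and z: "z = (\<lambda>x. pairv n (\<lambda>x. \<Sum>i<length ts. c i * (ts ! i) x)
          (\<lambda>x. \<Sum>i<length ts. c i * (\<Sum>j<length ts. A $$ (i, j) * (ts ! j) x)) x
        + (pairv n \<rho> (\<lambda>x. 0) x + pairv n (\<lambda>x. 0) \<rho>' x))"
      unfolding steane_code_def steane_rows_eq rowspace_append rowspace_steane_top rowspace_left
        rowspace_right
      by (elim CollectE exE conjE imageE) simp
    show "z \<in> ?R"
      unfolding z * using c by (intro CollectI exI conjI) (rule refl)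
  next
    fix z assume "z \<in> ?R"
    then obtain c \<rho> \<rho>' where c: "\<forall>i<length ts. c i \<in> F" "\<rho> \<in> rowspace F rs" "\<rho>' \<in> rowspace F rs"
      and z: "z = pairv n (\<lambda>x. (\<Sum>i<length ts. c i * (ts ! i) x) + \<rho> x)
       (\<lambda>x. (\<Sum>i<length ts. c i * (\<Sum>j<length ts. A $$ (i, j) * (ts ! j) x)) + \<rho>' x)"
      by (elim CollectE exE conjE) simp
    show "z \<in> steane_code F n rs ts A"
      unfolding z steane_code_def steane_rows_eq rowspace_append rowspace_steane_top rowspace_left
        rowspace_right *[symmetric] using c
      by (intro CollectI exI conjI) (rule refl | (rule rev_image_eqI, assumption, rule refl) | assumption)+
  qed
qed

context subfield_set
begin

text \<open>The left halves decide, whatever \<open>A\<close> is: a word common to the top block and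
  the lower two has its left half in both row spaces, so this half is zero and the independence of
  \<open>ts\<close> kills the coefficients of the top block.\<close>

lemma lin_indep_steane_rows:
  assumes rs: "lin_indep_rows F rs" and ts: "lin_indep_rows F ts"
    and int: "rowspace F rs \<inter> rowspace F ts \<subseteq> {\<lambda>x. 0}"
    and rsF: "set rs \<subseteq> Fvecs F n" and tsF: "set ts \<subseteq> Fvecs F n"
  shows "lin_indep_rows F (steane_rows n rs ts A)"
proof -
  have vanR: "\<forall>x\<ge>n. u x = 0" if "u \<in> rowspace F rs" for u
    using rowspace_subset_Fvecs[OF rsF] that by (auto simp: Fvecs_def)
  have vanT: "\<forall>x\<ge>n. u x = 0" if "u \<in> rowspace F ts" for u
    using rowspace_subset_Fvecs[OF tsF] that by (auto simp: Fvecs_def)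
  have rcomb: "(\<lambda>x. \<Sum>i<length rs. c i * (rs ! i) x) \<in> rowspace F rs" if "\<forall>i<length rs. c i \<in> F" for c
    using that by (auto simp: rowspace_def)
  have tcomb: "(\<lambda>x. \<Sum>i<length ts. c i * (ts ! i) x) \<in> rowspace F ts" if "\<forall>i<length ts. c i \<in> F" for c
    using that by (auto simp: rowspace_def)
  have top: "lin_indep_rows F (steane_top n ts A)"
    unfolding lin_indep_rows_def
  proof (intro allI impI)
    fix c i assume c: "(\<forall>i<length (steane_top n ts A). c i \<in> F) \<and>
      (\<lambda>x. \<Sum>i<length (steane_top n ts A). c i * (steane_top n ts A ! i) x) = (\<lambda>x. 0)"
      and i: "i < length (steane_top n ts A)"
    have cF: "\<forall>i<length ts. c i \<in> F" using c by (simp add: steane_top_def)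
    have "pairv n (\<lambda>x. \<Sum>i<length ts. c i * (ts ! i) x)
       (\<lambda>x. \<Sum>i<length ts. c i * (\<Sum>j<length ts. A $$ (i, j) * (ts ! j) x)) = pairv n (\<lambda>x. 0) (\<lambda>x. 0)"
      using conjunct2[OF c] unfolding steane_top_comb pairv_zero .
    then have "(\<lambda>x. \<Sum>i<length ts. c i * (ts ! i) x) = (\<lambda>x. 0)"
      by (rule pairv_eqD1) (use vanT[OF tcomb[OF cF]] in auto)
    then have "\<forall>i<length ts. c i = 0"
      using lin_indep_rowsD[OF ts cF] by blast
    then show "c i = 0" using i by (simp add: steane_top_def)
  qed
  have left: "lin_indep_rows F (map (\<lambda>r. pairv n r (\<lambda>x. 0)) rs)"
    unfolding lin_indep_rows_def
  proof (intro allI impI)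
    fix c i assume c: "(\<forall>i<length (map (\<lambda>r. pairv n r (\<lambda>x. 0)) rs). c i \<in> F) \<and>
      (\<lambda>x. \<Sum>i<length (map (\<lambda>r. pairv n r (\<lambda>x. 0)) rs). c i * (map (\<lambda>r. pairv n r (\<lambda>x. 0)) rs ! i) x) = (\<lambda>x. 0)"
      and i: "i < length (map (\<lambda>r. pairv n r (\<lambda>x. 0)) rs)"
    have cF: "\<forall>i<length rs. c i \<in> F" using c by simp
    have "(\<lambda>x. \<Sum>i<length rs. c i * pairv n (rs ! i) (\<lambda>x. 0) x) = (\<lambda>x. 0)"
      using conjunct2[OF c] by simp
    then have "pairv n (\<lambda>x. \<Sum>i<length rs. c i * (rs ! i) x) (\<lambda>x. 0) = pairv n (\<lambda>x. 0) (\<lambda>x. 0)"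
      unfolding comb_pairv by (simp add: pairv_zero)
    then have "(\<lambda>x. \<Sum>i<length rs. c i * (rs ! i) x) = (\<lambda>x. 0)"
      by (rule pairv_eqD1) (use vanR[OF rcomb[OF cF]] in auto)
    then show "c i = 0" using i by (intro lin_indep_rowsD[OF rs cF]) auto
  qed
  have right: "lin_indep_rows F (map (\<lambda>r. pairv n (\<lambda>x. 0) r) rs)"
    unfolding lin_indep_rows_def
  proof (intro allI impI)
    fix c i assume c: "(\<forall>i<length (map (\<lambda>r. pairv n (\<lambda>x. 0) r) rs). c i \<in> F) \<and>
      (\<lambda>x. \<Sum>i<length (map (\<lambda>r. pairv n (\<lambda>x. 0) r) rs). c i * (map (\<lambda>r. pairv n (\<lambda>x. 0) r) rs ! i) x) = (\<lambda>x. 0)"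
      and i: "i < length (map (\<lambda>r. pairv n (\<lambda>x. 0) r) rs)"
    have "pairv n (\<lambda>x. 0) (\<lambda>x. \<Sum>i<length rs. c i * (rs ! i) x) = pairv n (\<lambda>x. 0) (\<lambda>x. 0)"
      using conjunct2[OF c] comb_pairv[of c n "\<lambda>_ _. 0" "(!) rs" "length rs"]
      by (simp add: pairv_zero)
    then have "(\<lambda>x. \<Sum>i<length rs. c i * (rs ! i) x) = (\<lambda>x. 0)" by (rule pairv_eqD2)
    then show "c i = 0" using c i by (intro lin_indep_rowsD[OF rs]) auto
  qed
  show ?thesis unfolding steane_rows_eq
  proof (intro lin_indep_append top left right; intro subsetI; elim IntE)
    fix z assume "z \<in> rowspace F (map (\<lambda>r. pairv n r (\<lambda>x. 0)) rs)"
      "z \<in> rowspace F (map (\<lambda>r. pairv n (\<lambda>x. 0) r) rs)"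
    then obtain \<rho> \<rho>' where z: "\<rho> \<in> rowspace F rs" "z = pairv n \<rho> (\<lambda>x. 0)" "z = pairv n (\<lambda>x. 0) \<rho>'"
      unfolding rowspace_left rowspace_right by blast
    then have "\<rho> = (\<lambda>x. 0)" using pairv_eqD1[of n \<rho> _ "\<lambda>x. 0" \<rho>'] vanR[OF z(1)] by auto
    then show "z \<in> {\<lambda>x. 0}" using z(2) by (simp add: pairv_zero)
  next
    fix z assume "z \<in> rowspace F (steane_top n ts A)"
      and z2: "z \<in> rowspace F (map (\<lambda>r. pairv n r (\<lambda>x. 0)) rs @ map (\<lambda>r. pairv n (\<lambda>x. 0) r) rs)"
    then obtain c where cF: "\<forall>i<length ts. c i \<in> F"
      and z: "z = pairv n (\<lambda>x. \<Sum>i<length ts. c i * (ts ! i) x)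
       (\<lambda>x. \<Sum>i<length ts. c i * (\<Sum>j<length ts. A $$ (i, j) * (ts ! j) x))"
      unfolding rowspace_steane_top by blast
    from z2 obtain \<rho> \<rho>' where r: "\<rho> \<in> rowspace F rs" "\<rho>' \<in> rowspace F rs"
      and "z = (\<lambda>x. pairv n \<rho> (\<lambda>x. 0) x + pairv n (\<lambda>x. 0) \<rho>' x)"
      unfolding rowspace_append rowspace_left rowspace_right by blast
    then have z': "z = pairv n \<rho> \<rho>'" by (auto simp: pairv_def)
    have "(\<lambda>x. \<Sum>i<length ts. c i * (ts ! i) x) = \<rho>"
      by (rule pairv_eqD1[OF z[symmetric, unfolded z']]) (use vanR[OF r(1)] vanT[OF tcomb[OF cF]] in auto)
    then have "(\<lambda>x. \<Sum>i<length ts. c i * (ts ! i) x) = (\<lambda>x. 0)"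
      using int r(1) tcomb[OF cF] by blast
    then have c0: "\<forall>i<length ts. c i = 0"
      using lin_indep_rowsD[OF ts cF] by blast
    then show "z \<in> {\<lambda>x. 0}" unfolding z by (auto simp: pairv_def)
  qed
qed

lemma dimF_steane_code:
  assumes "lin_indep_rows F rs" "lin_indep_rows F ts"
    and "rowspace F rs \<inter> rowspace F ts \<subseteq> {\<lambda>x. 0}"
    and "set rs \<subseteq> Fvecs F n" "set ts \<subseteq> Fvecs F n"
  shows "dimF F (steane_code F n rs ts A) = length ts + 2 * length rs"
  unfolding steane_code_def dimF_rowspace[OF lin_indep_steane_rows[OF assms]]
  by (simp add: steane_rows_def)

end

section \<open>Trace and bases of a finite field\<close>

text \<open>Multiplication by \<open>x\<close> permutes the nonzero elements, so their product,
  which is nonzero, picks up this power of \<open>x\<close> without changing.\<close>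

lemma finite_field_pow_card_minus_1:
  fixes x :: "'a::{field,finite}"
  assumes "x \<noteq> 0"
  shows "x ^ (card (UNIV :: 'a set) - 1) = 1"
proof -
  have "(\<Prod>y\<in>UNIV-{0}. x * y) = (\<Prod>y\<in>UNIV-{0::'a}. y)"
    by (rule prod.reindex_bij_witness[of _ "\<lambda>y. y / x" "\<lambda>y. x * y"]) (use assms in auto)
  then have "x ^ (card (UNIV :: 'a set) - 1) * (\<Prod>y\<in>UNIV-{0::'a}. y) = (\<Prod>y\<in>UNIV-{0::'a}. y)"
    by (simp add: prod.distrib)
  then show ?thesis by simp
qed

locale finite_ext =
  fixes p s r :: nat and \<beta> :: "nat \<Rightarrow> 'a::{field,finite}"
  assumes prime_p: "prime p" and s_pos: "0 < s" and r_pos: "0 < r" and even_r: "even r"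
    and card_UNIV_pow: "card (UNIV :: 'a set) = p ^ (s * r)"
    and bij_beta: "bij_betw \<beta> {0..<p ^ (s * r) - 1} (UNIV - {0})"
begin

definition "q = p ^ s"
text \<open>The square root of the order of the field: \<open>x \<mapsto> x ^ Q\<close> is the
  automorphism of order two.\<close>

definition "Q = q ^ (r div 2)"
definition "n = q ^ r - 1"
definition F :: "'a set" where "F = subfield_pow q"
definition tr :: "'a \<Rightarrow> 'a" where "tr x = (\<Sum>l<r. x ^ (q ^ l))"

lemma q_gt_1: "1 < q"
  unfolding q_def by (intro one_less_power prime_gt_1_nat prime_p s_pos)

lemma r_ge_2: "2 \<le> r"
  using r_pos even_r by presburger

lemma qr_eq: "q ^ r = p ^ (s * r)"
  by (simp add: q_def power_mult)

lemma card_UNIV: "card (UNIV :: 'a set) = q ^ r"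
  by (simp add: card_UNIV_pow qr_eq)

lemma Q_times_Q: "Q * Q = q ^ r"
proof -
  have "r div 2 + r div 2 = r" using even_r by presburger
  then show ?thesis by (simp add: Q_def flip: power_add)
qed

lemma q_le_Q: "q \<le> Q"
  unfolding Q_def using q_gt_1 r_ge_2 self_le_power[of q "r div 2"] by simp

lemma Q_gt_1: "1 < Q"
  using q_gt_1 q_le_Q by simp

lemma n_eq: "n = (Q - 1) * (Q + 1)"
proof -
  have "(Q - 1) * (Q + 1) = Q * Q - 1"
    using Q_gt_1 by (simp add: algebra_simps)
  then show ?thesis by (simp add: n_def Q_times_Q)
qed

lemma n_pos: "0 < n"
  unfolding n_eq using Q_gt_1 by simp

lemma qr_n: "q ^ r = n + 1"
  unfolding n_def using q_gt_1 by simp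

lemma Q_lt_n: "Q \<le> n"
  unfolding n_eq using Q_gt_1 by (cases "Q - 1") auto

lemma bij_betw_beta_nonzero: "bij_betw \<beta> {..<n} (UNIV - {0})"
  using bij_beta by (simp add: n_def qr_eq lessThan_atLeast0)

lemma beta_nz: "j < n \<Longrightarrow> \<beta> j \<noteq> 0"
  using bij_betw_beta_nonzero by (auto simp: bij_betw_def)

lemma pow_n: "x \<noteq> 0 \<Longrightarrow> x ^ n = (1::'a)"
  using finite_field_pow_card_minus_1[of x] by (simp add: card_UNIV n_def)

lemma pow_mod_n: "x \<noteq> 0 \<Longrightarrow> (x::'a) ^ (i mod n) = x ^ i"
proof -
  assume x: "x \<noteq> 0"
  have "x ^ i = x ^ (n * (i div n) + i mod n)" by simp
  also have "\<dots> = x ^ (i mod n)" unfolding power_add power_mult by (simp add: pow_n[OF x])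
  finally show ?thesis by simp
qed

lemma pow_qr: "(x::'a) ^ (q ^ r) = x"
  using pow_n[of x] n_pos by (cases "x = 0") (auto simp: qr_n)

text \<open>Translation by 1 permutes the field; comparing the sums of all elements shows that the
  order of the field is zero in it, so the prime characteristic divides a power of
  \<open>p\<close>.\<close>

lemma CHAR_eq: "CHAR('a) = p"
proof -
  have "prime CHAR('a)"
    by (rule prime_CHAR_semidom, rule finite_imp_CHAR_pos) simp
  moreover have "(\<Sum>x\<in>UNIV. x + 1) = (\<Sum>x\<in>(UNIV :: 'a set). x)"
    by (rule sum.reindex_bij_witness[of _ "\<lambda>x. x - 1" "\<lambda>x. x + 1"]) auto
  then have "of_nat (card (UNIV :: 'a set)) = (0::'a)"
    by (simp add: sum.distrib)
  then have "CHAR('a) dvd p ^ (s * r)"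
    by (simp only: of_nat_eq_0_iff_char_dvd card_UNIV_pow)
  ultimately show ?thesis
    using prime_p prime_dvd_power primes_dvd_imp_eq by blast
qed

lemma frob_add: "(x + y :: 'a) ^ (q ^ l) = x ^ (q ^ l) + y ^ (q ^ l)"
  by (rule freshmans_dream'[of _ "s * l"]) (simp_all add: CHAR_eq prime_p q_def power_mult)

lemma frob_sum: "(\<Sum>i\<in>I. g i :: 'a) ^ (q ^ l) = (\<Sum>i\<in>I. g i ^ (q ^ l))"
  by (rule freshmans_dream_sum'[of _ "s * l"]) (simp_all add: CHAR_eq prime_p q_def power_mult)

lemma frob_minus: "(- x :: 'a) ^ (q ^ l) = - (x ^ (q ^ l))"
  using frob_add[of x "- x" l] q_gt_1 by (simp add: power_0_left add_eq_0_iff)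

lemma F_iff: "x \<in> F \<longleftrightarrow> x ^ q = x"
  by (simp add: F_def subfield_pow_def)

sublocale subfield_set F
proof
  fix x y assume "x \<in> F" "y \<in> F"
  then show "x + y \<in> F" "x * y \<in> F" "- x \<in> F" "inverse x \<in> F"
    using frob_add[of x y 1] frob_minus[of x 1]
    by (simp_all add: F_iff power_mult_distrib power_inverse)
qed (use q_gt_1 in \<open>auto simp: F_iff\<close>)

lemma F_pow: "x \<in> F \<Longrightarrow> x ^ (q ^ l) = x"
  by (induction l) (simp_all add: power_mult F_iff)

section \<open>The trace onto \<open>F\<close> and its values\<close>

lemma tr_0 [simp]: "tr 0 = 0"
  using q_gt_1 by (simp add: tr_def power_0_left)

lemma tr_add: "tr (x + y) = tr x + tr y"
  by (simp add: tr_def frob_add sum.distrib)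

lemma tr_minus: "tr (- x) = - tr x"
  by (simp add: tr_def frob_minus sum_negf)

lemma tr_sum: "tr (\<Sum>i\<in>I. g i) = (\<Sum>i\<in>I. tr (g i))"
  by (induction I rule: infinite_finite_induct) (auto simp: tr_add)

lemma tr_scale: "c \<in> F \<Longrightarrow> tr (c * x) = c * tr x"
  by (simp add: tr_def power_mult_distrib F_pow sum_distrib_left)

text \<open>Raising to the power \<open>q\<close> shifts the summands cyclically, because
  \<open>x ^ (q ^ r) = x\<close>.\<close>

lemma tr_frob1: "tr (x ^ q) = tr x"
proof -
  have "tr (x ^ q) = (\<Sum>l<r. x ^ (q ^ Suc l))"
    by (simp add: tr_def flip: power_mult)
  also have "\<dots> = (\<Sum>l<Suc r. x ^ (q ^ l)) - x"
    by (subst sum.lessThan_Suc_shift) simp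
  also have "\<dots> = tr x" by (simp add: tr_def pow_qr)
  finally show ?thesis .
qed

lemma tr_frob: "tr (x ^ (q ^ l)) = tr x"
  by (induction l) (simp_all add: tr_frob1 mult.commute[of q] power_mult)

lemma tr_mem: "tr x \<in> F"
proof -
  have "tr x ^ q = (tr x) ^ (q ^ 1)" by simp
  also have "\<dots> = tr (x ^ q)" unfolding tr_def frob_sum
    by (simp add: mult.commute flip: power_mult)
  finally show ?thesis by (simp add: F_iff tr_frob1)
qed

text \<open>\<open>tr x - y\<close> is a polynomial in \<open>x\<close> of degree
  \<open>q ^ (r - 1)\<close>. Fibres this small force at least \<open>q\<close> values of the trace
  on \<open>q ^ r\<close> elements.\<close>

lemma card_tr_fibre: "card {x. tr x = y} \<le> q ^ (r - 1)"
proof -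
  define P :: "'a poly" where "P = (\<Sum>l<r. monom 1 (q ^ l)) - [:y:]"
  have "poly P x = tr x - y" for x
    by (simp add: P_def tr_def poly_sum poly_monom)
  then have eq: "{x. tr x = y} = {x. poly P x = 0}" by simp
  have "q ^ l = q ^ (r - 1) \<longleftrightarrow> l = r - 1" for l
    using q_gt_1 by simp
  moreover have "coeff [:y:] (q ^ (r - 1)) = 0"
    by (rule coeff_eq_0) (use q_gt_1 in simp)
  ultimately have "coeff P (q ^ (r - 1)) = (\<Sum>l<r. if l = r - 1 then 1 else 0)"
    unfolding P_def coeff_diff coeff_sum coeff_monom by simp
  then have "coeff P (q ^ (r - 1)) = 1" using r_pos by simp
  then have "P \<noteq> 0" by auto
  moreover have "degree P \<le> q ^ (r - 1)"
    unfolding P_def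
  proof (intro degree_diff_le degree_sum_le)
    fix l assume "l \<in> {..<r}"
    then have "q ^ l \<le> q ^ (r - 1)" using q_gt_1 by (intro power_increasing) auto
    then show "degree (monom (1::'a) (q ^ l)) \<le> q ^ (r - 1)"
      by (rule order_trans[OF degree_monom_le])
  qed auto
  ultimately show ?thesis using card_poly_roots_bound[of P] eq by simp
qed

lemma card_pow_fix:
  assumes "1 < k"
  shows "card {x::'a. x ^ k = x} \<le> k"
proof -
  define P :: "'a poly" where "P = monom 1 k - monom 1 1"
  have "{x. x ^ k = x} = {x. poly P x = 0}" by (simp add: P_def poly_monom)
  moreover have "coeff P k = 1" using assms by (simp add: P_def)
  then have "P \<noteq> 0" by auto
  moreover have "degree P \<le> k" unfolding P_def using assms
    by (intro degree_diff_le order_trans[OF degree_monom_le]) auto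
  ultimately show ?thesis using card_poly_roots_bound[of P] by simp
qed

lemma tr_range_card: "q \<le> card (range tr)"
proof -
  have "q ^ r = card (\<Union>y\<in>range tr. {x. tr x = y})"
    by (simp add: card_UNIV[symmetric]) (rule arg_cong[of _ _ card], auto)
  also have "\<dots> \<le> (\<Sum>y\<in>range tr. card {x. tr x = y})"
    by (rule card_UN_le) simp
  also have "\<dots> \<le> (\<Sum>y\<in>range tr. q ^ (r - 1))"
    by (rule sum_mono) (rule card_tr_fibre)
  finally have "q * q ^ (r - 1) \<le> card (range tr) * q ^ (r - 1)"
    using r_pos by (cases r) auto
  then show ?thesis using q_gt_1 by simp
qed

lemma card_F_le: "card F \<le> q"
  using card_pow_fix[OF q_gt_1] by (simp add: F_def subfield_pow_def)

text \<open>A squeeze: the range lies in \<open>F\<close>, which has at most \<open>q\<close>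
  elements as the root set of \<open>X ^ q - X\<close>, and it has at least \<open>q\<close>
  elements itself. This also gives the order of \<open>F\<close>.\<close>

lemma range_tr: "range tr = F"
proof (rule card_seteq)
  show "card F \<le> card (range tr)" using card_F_le tr_range_card by simp
qed (auto simp: tr_mem)

lemma card_F: "card F = q"
  using card_F_le tr_range_card by (simp add: range_tr)

lemma tr_surj: "y \<in> F \<Longrightarrow> \<exists>x. tr x = y"
  unfolding range_tr[symmetric] by auto

text \<open>A nonzero \<open>x\<close> has a multiple of trace 1. This will turn orthogonality
  conditions over \<open>F\<close> into equations in the large field.\<close>

lemma tr_nondeg:
  assumes "\<And>\<gamma>. tr (\<gamma> * x) = 0"
  shows "x = 0"
proof (rule ccontr)
  assume x: "x \<noteq> 0"
  obtain t where t: "tr t = 1" using tr_surj[OF one_mem] by blast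
  have "(t / x) * x = t" using x by simp
  then show False using assms[of "t / x"] t by simp
qed

text \<open>\<open>X ^ Q - X\<close> has at most \<open>Q\<close> roots, fewer than the
  \<open>Q * Q\<close> elements of the field.\<close>

lemma ex_omega: "\<exists>w::'a. w ^ Q \<noteq> w"
proof (rule ccontr)
  assume "\<not> ?thesis"
  then have "{x::'a. x ^ Q = x} = UNIV" by auto
  then have "Q * Q \<le> Q * 1" using card_pow_fix[OF Q_gt_1] by (simp add: card_UNIV Q_times_Q)
  then show False using Q_gt_1 by (simp only: mult_le_cancel1) simp
qed

definition "omega = (SOME w::'a. w ^ Q \<noteq> w)"

lemma omega: "omega ^ Q \<noteq> omega"
  unfolding omega_def by (rule someI_ex[OF ex_omega])

lemma omega_notin_F: "omega \<notin> F"
  using omega F_pow[of omega "r div 2"] by (auto simp: Q_def)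

section \<open>Power sums over the nonzero elements\<close>

lemma sum_beta: "(\<Sum>j<n. g (\<beta> j)) = (\<Sum>x\<in>UNIV - {0}. g x)"
  by (rule sum.reindex_bij_betw[OF bij_betw_beta_nonzero])

lemma of_nat_n: "of_nat n = (- 1 :: 'a)"
proof -
  have "of_nat (n + 1) = (0::'a)"
    unfolding qr_n[symmetric] of_nat_eq_0_iff_char_dvd CHAR_eq q_def
    using s_pos r_pos by (simp flip: power_mult)
  then show ?thesis by (simp add: eq_neg_iff_add_eq_0 add.commute)
qed

text \<open>Replacing \<open>x\<close> by \<open>y * x\<close> multiplies the sum by
  \<open>y ^ k\<close>, so it vanishes once some \<open>y\<close> has
  \<open>y ^ k \<noteq> 1\<close>. If \<open>n\<close> divides \<open>k\<close>, all
  \<open>n\<close> terms are 1, and \<open>n\<close> equals -1 in the field.\<close>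

lemma power_sum: "(\<Sum>j<n. \<beta> j ^ k) = (if n dvd k then - 1 else 0)"
proof (cases "n dvd k")
  case True
  then obtain t where t: "k = n * t" ..
  have "(\<Sum>j<n. \<beta> j ^ k) = (\<Sum>j<n. 1)"
    by (rule sum.cong) (simp_all add: t power_mult pow_n beta_nz)
  then show ?thesis using True of_nat_n by simp
next
  case False
  define k' where "k' = k mod n"
  have k': "0 < k'" "k' < n" using False n_pos by (auto simp: k'_def mod_greater_zero_iff_not_dvd)
  \<comment> \<open>Otherwise all \<open>n + 1\<close> field elements would be roots of
    \<open>X ^ (k' + 1) - X\<close>, whose degree is at most \<open>n\<close>.\<close>
  have "\<exists>y::'a. y \<noteq> 0 \<and> y ^ k' \<noteq> 1"
  proof (rule ccontr)
    assume "\<not> ?thesis"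
    then have "y ^ (k' + 1) = y" for y :: 'a using k' by (cases "y = 0") auto
    then have "{x::'a. x ^ (k' + 1) = x} = UNIV" by auto
    then have "q ^ r \<le> k' + 1" using card_pow_fix[of "k' + 1"] k' by (simp add: card_UNIV)
    then show False using k' by (simp add: qr_n)
  qed
  then obtain y :: 'a where y: "y \<noteq> 0" "y ^ k' \<noteq> 1" by blast
  define S where "S = (\<Sum>x\<in>UNIV - {0::'a}. x ^ k)"
  have "S = (\<Sum>x\<in>UNIV - {0::'a}. (y * x) ^ k)"
    unfolding S_def
    by (rule sum.reindex_bij_witness[of _ "\<lambda>x. y * x" "\<lambda>x. x / y"]) (use y in auto)
  also have "\<dots> = y ^ k * S" by (simp add: S_def power_mult_distrib sum_distrib_left)
  finally have "(y ^ k - 1) * S = 0" by (simp add: algebra_simps)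
  moreover have "y ^ k \<noteq> 1" using y pow_mod_n[of y k] by (simp add: k'_def)
  ultimately have "S = 0" by simp
  then show ?thesis using False sum_beta[of "\<lambda>x. x ^ k"] by (simp add: S_def)
qed

section \<open>A basis of the large field over \<open>F\<close>\<close>

lemma ex_basis:
  "\<exists>b. (\<forall>x. \<exists>c. (\<forall>k<r. c k \<in> F) \<and> x = (\<Sum>k<r. c k * b k)) \<and>
       (\<forall>c. (\<forall>k<r. c k \<in> F) \<longrightarrow> (\<Sum>k<r. c k * b k) = 0 \<longrightarrow> (\<forall>k<r. c k = 0))"
proof -
  \<comment> \<open>Field elements are viewed as constant functions, so that the counting results
    for rows apply to the field as a vector space over \<open>F\<close>.\<close>
  define cst :: "'a \<Rightarrow> nat \<Rightarrow> 'a" where "cst = (\<lambda>x _. x)"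
  define ind where "ind bs \<longleftrightarrow> lin_indep_rows F (map cst bs)" for bs
  have sub: "rowspace F (map cst bs) \<subseteq> range cst" for bs
    by (auto simp: rowspace_def cst_def)
  have inj: "inj cst" by (auto simp: inj_on_def cst_def fun_eq_iff)
  have len: "length bs \<le> r" if "ind bs" for bs
  proof -
    have "q ^ length bs = card (rowspace F (map cst bs))"
      using card_rowspace[of "map cst bs"] that by (simp add: ind_def card_F)
    also have "\<dots> \<le> card (range cst)" by (rule card_mono[OF _ sub]) simp
    also have "\<dots> = q ^ r" by (simp add: card_image[OF inj] card_UNIV)
    finally show ?thesis using q_gt_1 by simp
  qed
  have "ind []" by (simp add: ind_def lin_indep_rows_def)
  \<comment> \<open>A longest independent list. It spans, since an element outside its span could be
    appended.\<close>
  then obtain bs where bs: "ind bs" and max: "\<And>bs'. ind bs' \<Longrightarrow> length bs' \<le> length bs"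
    using ex_has_greatest_nat[of ind "[]" length "Suc r"] len by (metis le_imp_less_Suc)
  have span: "rowspace F (map cst bs) = range cst"
  proof (rule ccontr)
    assume "\<not> ?thesis"
    then obtain x where x: "cst x \<notin> rowspace F (map cst bs)" using sub by blast
    have "lin_indep_rows F [cst x]" unfolding lin_indep_rows_def
    proof (intro allI impI)
      fix c i assume "(\<forall>i<length [cst x]. c i \<in> F) \<and>
        (\<lambda>y. \<Sum>i<length [cst x]. c i * ([cst x] ! i) y) = (\<lambda>x. 0)" "i < length [cst x]"
      moreover have "x \<noteq> 0" using x zero_in_rowspace by (auto simp: cst_def)
      ultimately show "c i = 0" by (auto simp: cst_def fun_eq_iff)
    qed
    moreover have "rowspace F (map cst bs) \<inter> rowspace F [cst x] \<subseteq> {\<lambda>x. 0}"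
    proof
      fix v assume v: "v \<in> rowspace F (map cst bs) \<inter> rowspace F [cst x]"
      then obtain a where a: "a \<in> F" "v = (\<lambda>y. a * cst x y)" by (auto simp: rowspace_def)
      show "v \<in> {\<lambda>x. 0}"
      proof (rule ccontr)
        assume "v \<notin> {\<lambda>x. 0}"
        then have a0: "a \<noteq> 0" using a by auto
        obtain c where c: "\<forall>i<length (map cst bs). c i \<in> F"
          "v = (\<lambda>x. \<Sum>i<length (map cst bs). c i * (map cst bs ! i) x)"
          using v by (auto simp: rowspace_def)
        have "cst x = (\<lambda>y. inverse a * v y)" using a a0 by auto
        also have "\<dots> = (\<lambda>x. \<Sum>i<length (map cst bs). (inverse a * c i) * (map cst bs ! i) x)"
          unfolding c(2) by (simp add: sum_distrib_left mult.assoc)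
        also have "\<dots> \<in> rowspace F (map cst bs)"
          by (rule rowspaceI) (use a c in \<open>auto intro: mult_mem inverse_mem\<close>)
        finally show False using x by simp
      qed
    qed
    ultimately have "ind (bs @ [x])"
      using bs lin_indep_append[of "map cst bs" "[cst x]"] by (simp add: ind_def)
    then show False using max[of "bs @ [x]"] by simp
  qed
  have "q ^ length bs = card (range cst)"
    using card_rowspace[of "map cst bs"] bs by (simp add: ind_def card_F span)
  also have "\<dots> = q ^ r" by (simp add: card_image[OF inj] card_UNIV)
  finally have lr: "length bs = r" using q_gt_1 by simp
  show ?thesis
  proof (rule exI[of _ "(!) bs"], intro conjI allI impI)
    fix x
    have "cst x \<in> rowspace F (map cst bs)" by (simp add: span)
    then obtain c where "\<forall>k<r. c k \<in> F" "cst x = (\<lambda>y. \<Sum>k<r. c k * (map cst bs ! k) y)"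
      by (auto simp: rowspace_def lr)
    then show "\<exists>c. (\<forall>k<r. c k \<in> F) \<and> x = (\<Sum>k<r. c k * bs ! k)"
      by (intro exI[of _ c]) (auto simp: cst_def fun_eq_iff lr)
  next
    fix c k assume c: "\<forall>k<r. c k \<in> F" "(\<Sum>k<r. c k * bs ! k) = 0" "k < r"
    show "c k = 0"
      by (rule lin_indep_rowsD[OF bs[unfolded ind_def], of c])
        (use c in \<open>auto simp: cst_def lr\<close>)
  qed
qed

definition "bas = (SOME b. (\<forall>x. \<exists>c. (\<forall>k<r. c k \<in> F) \<and> x = (\<Sum>k<r. c k * b k)) \<and>
       (\<forall>c. (\<forall>k<r. c k \<in> F) \<longrightarrow> (\<Sum>k<r. c k * b k) = 0 \<longrightarrow> (\<forall>k<r. c k = 0)))"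

definition "coord x = (SOME c. (\<forall>k<r. c k \<in> F) \<and> x = (\<Sum>k<r. c k * bas k))"

lemma coord_mem: "k < r \<Longrightarrow> coord x k \<in> F"
  and coord_sum: "(\<Sum>k<r. coord x k * bas k) = x"
proof -
  have "\<exists>c. (\<forall>k<r. c k \<in> F) \<and> x = (\<Sum>k<r. c k * bas k)"
    using someI_ex[OF ex_basis] unfolding bas_def by blast
  from someI_ex[OF this, folded coord_def]
  show "k < r \<Longrightarrow> coord x k \<in> F" "(\<Sum>k<r. coord x k * bas k) = x" by simp_all
qed

lemma bas_indep:
  assumes "\<And>k. k < r \<Longrightarrow> c k \<in> F" "(\<Sum>k<r. c k * bas k) = 0" "k < r"
  shows "c k = 0"
  using someI_ex[OF ex_basis] assms unfolding bas_def by blast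

lemma coord_unique:
  assumes "\<And>k. k < r \<Longrightarrow> c k \<in> F" "(\<Sum>k<r. c k * bas k) = x" "k < r"
  shows "coord x k = c k"
proof -
  have "coord x k - c k = 0"
    by (rule bas_indep) (use assms coord_sum[of x] in \<open>auto simp: algebra_simps sum_subtractf coord_mem diff_mem\<close>)
  then show ?thesis by simp
qed

lemma coord_add: "k < r \<Longrightarrow> coord (x + y) k = coord x k + coord y k"
  by (rule coord_unique) (auto simp: add_mem coord_mem distrib_right sum.distrib coord_sum)

lemma coord_scale: "a \<in> F \<Longrightarrow> k < r \<Longrightarrow> coord (a * x) k = a * coord x k"
  by (rule coord_unique)
    (auto simp: mult_mem coord_mem mult.assoc coord_sum simp flip: sum_distrib_left)

lemma coord_combine: "(\<And>i. i \<in> I \<Longrightarrow> a i \<in> F) \<Longrightarrow> k < r \<Longrightarrow>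
    coord (\<Sum>i\<in>I. a i * x i) k = (\<Sum>i\<in>I. a i * coord (x i) k)"
proof (induction I rule: infinite_finite_induct)
  case (insert i I)
  then show ?case by (simp add: coord_add coord_scale)
qed (use coord_scale[of 0 k 0] zero_mem in auto)

end

section \<open>The Steane enlargement of a BCH code\<close>

text \<open>What the argument uses of the minimal representatives: their order, the disjointness of
  the cosets, and that each exponent below a representative lies in the coset of an earlier one. Of
  the indices beyond \<open>l2\<close>, only \<open>Suc l2\<close> occurs.\<close>

locale bch_code = finite_ext p s r \<beta>
  for p s r :: nat and \<beta> :: "nat \<Rightarrow> 'a::{field,finite}" +
  fixes a :: "nat \<Rightarrow> nat" and l1 l2 :: nat
  assumes a_0: "a 0 = 0"
    and a_l2: "a l2 = p ^ (s * (r div 2)) - 1"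
    and l1_lt_l2: "l1 < l2"
    and a_mono: "\<mu> < \<nu> \<Longrightarrow> \<nu> \<le> l2 \<Longrightarrow> a \<mu> < a \<nu>"
    and a_disj: "\<mu> \<le> l2 \<Longrightarrow> \<nu> \<le> l2 \<Longrightarrow> [a \<nu> * p ^ (t * s) = a \<mu>] (mod p ^ (s * r) - 1) \<Longrightarrow> \<mu> = \<nu>"
    and a_cover: "l \<le> l2 \<Longrightarrow> i < a (Suc l) \<Longrightarrow> \<exists>\<nu>\<le>l. \<exists>t. i = a \<nu> * p ^ (t * s) mod (p ^ (s * r) - 1)"
begin

section \<open>Cosets: their sizes and opposite exponents\<close>

lemma n_eq_p: "p ^ (s * r) - 1 = n"
  by (simp add: n_def qr_eq)

lemma q_pow_p: "p ^ (t * s) = q ^ t"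
  by (simp add: q_def mult.commute flip: power_mult)

lemma a_l2_Q: "a l2 = Q - 1"
  using a_l2 by (simp add: Q_def q_def power_mult)

lemma a_le: "\<nu> \<le> l2 \<Longrightarrow> a \<nu> \<le> Q - 1"
  using a_mono[of \<nu> l2] a_l2_Q by (cases "\<nu> = l2") auto

lemma a_lt: "\<nu> < l2 \<Longrightarrow> a \<nu> < Q - 1"
  using a_mono[of \<nu> l2] a_l2_Q by auto

lemma a_pos: "0 < \<nu> \<Longrightarrow> \<nu> \<le> l2 \<Longrightarrow> 0 < a \<nu>"
  using a_mono[of 0 \<nu>] by simp

lemma a_lt_n: "\<nu> \<le> l2 \<Longrightarrow> a \<nu> < n"
  using a_le[of \<nu>] Q_lt_n Q_gt_1 by simp

lemma qr_cong: "[q ^ r = 1] (mod n)"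
  unfolding qr_n cong_def by (metis mod_add_self1)

text \<open>\<open>n - a \<mu>\<close> plays the role of the exponent \<open>- a \<mu>\<close>
  within the natural numbers.\<close>

lemma dvd_neg_iff: "\<mu> \<le> l2 \<Longrightarrow> n dvd x + (n - a \<mu>) \<longleftrightarrow> [x = a \<mu>] (mod n)"
proof -
  assume m: "\<mu> \<le> l2"
  have "[x = a \<mu>] (mod n) \<longleftrightarrow> [x + (n - a \<mu>) = a \<mu> + (n - a \<mu>)] (mod n)"
    by (rule cong_add_rcancel_nat[symmetric])
  also have "a \<mu> + (n - a \<mu>) = n" using a_lt_n[OF m] by simp
  finally show ?thesis by (simp add: cong_def mod_eq_0_iff_dvd)
qed

text \<open>The nonzero cosets up to index \<open>l2\<close> have \<open>r\<close> elements: for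
  \<open>0 < k \<le> r div 2\<close> the positive number \<open>a \<nu> * (q ^ k - 1)\<close> is at
  most \<open>(Q - 1) * (Q - 1) < n\<close>, hence no multiple of \<open>n\<close>. A larger
  \<open>l\<close> is replaced by \<open>r - l\<close>.\<close>

lemma coset_full:
  assumes "0 < \<nu>" "\<nu> \<le> l2" "l < r" "[a \<nu> * q ^ l = a \<nu>] (mod n)"
  shows "l = 0"
proof (rule ccontr)
  assume l: "l \<noteq> 0"
  have *: "\<not> [a \<nu> * q ^ k = a \<nu>] (mod n)" if k: "0 < k" "k \<le> r div 2" for k
  proof
    assume "[a \<nu> * q ^ k = a \<nu>] (mod n)"
    then have "n dvd a \<nu> * q ^ k - a \<nu>"
      using q_gt_1 by (subst (asm) cong_altdef_nat) auto
    then have d: "n dvd a \<nu> * (q ^ k - 1)" by (simp add: algebra_simps)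
    have "q ^ k \<le> Q" unfolding Q_def using k q_gt_1 by (intro power_increasing) auto
    then have "a \<nu> * (q ^ k - 1) \<le> (Q - 1) * (Q - 1)"
      using a_le[OF assms(2)] by (intro mult_le_mono) auto
    moreover have "(Q - 1) * (Q - 1) < n" unfolding n_eq using Q_gt_1 by (cases Q) auto
    moreover have "1 < q ^ k" using q_gt_1 k by (intro one_less_power) auto
    then have "0 < a \<nu> * (q ^ k - 1)" using a_pos[OF assms(1,2)] by simp
    then have "n \<le> a \<nu> * (q ^ k - 1)" by (rule dvd_imp_le[OF d])
    ultimately show False by linarith
  qed
  show False
  proof (cases "l \<le> r div 2")
    case True
    then show False using * l assms(4) by simp
  next
    case False
    have "[a \<nu> * q ^ l * q ^ (r - l) = a \<nu> * q ^ (r - l)] (mod n)"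
      using assms(4) by (rule cong_scalar_right)
    moreover have "a \<nu> * q ^ l * q ^ (r - l) = a \<nu> * q ^ r"
      using assms(3) by (simp add: mult.assoc flip: power_add)
    moreover have "[a \<nu> * q ^ r = a \<nu> * 1] (mod n)" using qr_cong by (rule cong_scalar_left)
    ultimately have "[a \<nu> * q ^ (r - l) = a \<nu>] (mod n)"
      by (metis cong_sym cong_trans mult.right_neutral)
    then show False using *[of "r - l"] assms(3) False by simp
  qed
qed

text \<open>Multiplying by a power of \<open>q\<close> one may take \<open>k \<le> r div 2\<close>, and then the exponent is at most
  \<open>(Q - 1) * (Q + 1) = n\<close>, with equality only for \<open>a \<mu> = a \<nu> = Q - 1\<close>.\<close>

lemma opposite_exponents:
  assumes "\<mu> \<le> l2" "\<nu> \<le> l2" "k < r" "n dvd a \<mu> + a \<nu> * q ^ k"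
  shows "\<mu> = 0 \<and> \<nu> = 0 \<or> \<mu> = l2 \<and> \<nu> = l2 \<and> k = r div 2"
proof -
  have zero: "\<mu> = 0 \<and> \<nu> = 0" if "a \<mu> = 0" "a \<nu> = 0"
    using that a_pos assms(1,2) by fastforce
  have main: "a x + a y * q ^ j = 0 \<or> x = l2 \<and> y = l2 \<and> j = r div 2"
    if x: "x \<le> l2" and y: "y \<le> l2" and j: "j \<le> r div 2" and d: "n dvd a x + a y * q ^ j" for x y j
  proof (rule ccontr)
    assume neg: "\<not> ?thesis"
    have j1: "q ^ j \<le> Q" unfolding Q_def using j q_gt_1 by (intro power_increasing) auto
    have le: "a x + a y * q ^ j \<le> (Q - 1) + (Q - 1) * Q"
      using a_le[OF x] a_le[OF y] j1 by (intro add_mono mult_le_mono) auto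
    have eq: "(Q - 1) + (Q - 1) * Q = n" by (simp add: n_eq)
    have "a x + a y * q ^ j < n"
    proof (cases "x = l2 \<and> y = l2")
      case True
      with neg j have "j < r div 2" by auto
      then have "q ^ j < Q" unfolding Q_def using q_gt_1 by simp
      then have "(Q - 1) * q ^ j < (Q - 1) * Q" using Q_gt_1 by simp
      then have "(Q - 1) + (Q - 1) * q ^ j < n"
        unfolding eq[symmetric] by (rule add_strict_left_mono)
      then show ?thesis using True by (simp only: a_l2_Q)
    next
      case False
      then consider "x < l2" | "y < l2" using x y by linarith
      then show ?thesis
      proof cases
        case 1
        have "a y * q ^ j \<le> (Q - 1) * Q" using a_le[OF y] j1 by (intro mult_le_mono) auto
        then show ?thesis using a_lt[OF 1] by (simp flip: eq)
      next
        case 2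
        have "a y * q ^ j \<le> a y * Q" using j1 by simp
        also have "\<dots> < (Q - 1) * Q" using a_lt[OF 2] Q_gt_1 by simp
        finally show ?thesis using a_le[OF x] by (simp flip: eq)
      qed
    qed
    then show False using d neg dvd_imp_le[of n] by fastforce
  qed
  show ?thesis
  proof (cases "k \<le> r div 2")
    case True
    from main[OF assms(1,2) True assms(4)] show ?thesis using zero q_gt_1 by auto
  next
    case False
    have "n dvd (a \<mu> + a \<nu> * q ^ k) * q ^ (r - k)" using assms(4) by simp
    also have "(a \<mu> + a \<nu> * q ^ k) * q ^ (r - k) = a \<mu> * q ^ (r - k) + a \<nu> * q ^ r"
      using assms(3) by (simp add: algebra_simps flip: power_add)
    also have "\<dots> = a \<nu> + a \<mu> * q ^ (r - k) + a \<nu> * n" by (simp add: qr_n algebra_simps)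
    finally have "n dvd a \<nu> + a \<mu> * q ^ (r - k)" by simp
    \<comment> \<open>Here \<open>r - k < r div 2\<close>, so of the two alternatives only that of
      zero exponents remains.\<close>
    from main[OF assms(2,1) _ this] False assms(3) show ?thesis
      using zero q_gt_1 even_r by fastforce
  qed
qed

section \<open>Trace words and their transforms\<close>

definition dot :: "(nat \<Rightarrow> 'a) \<Rightarrow> (nat \<Rightarrow> 'a) \<Rightarrow> 'a" where
  "dot u v = (\<Sum>j<n. u j * v j)"

text \<open>The discrete Fourier (Mattson-Solomon) transform; its values at coset representatives
  are the syndromes that decide membership in the duals.\<close>

definition hat :: "(nat \<Rightarrow> 'a) \<Rightarrow> nat \<Rightarrow> 'a" where
  "hat u i = (\<Sum>j<n. u j * \<beta> j ^ i)"

definition tvec :: "nat \<Rightarrow> 'a \<Rightarrow> nat \<Rightarrow> 'a" where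
  "tvec \<nu> x = (\<lambda>j. if j < n then tr (x * \<beta> j ^ a \<nu>) else 0)"

text \<open>A word is described by one field parameter per coset; as \<open>a 0 = 0\<close>, the
  parameter at 0 enters only through its trace.\<close>

definition tsum :: "(nat \<Rightarrow> 'a) \<Rightarrow> nat \<Rightarrow> 'a" where
  "tsum \<gamma> = (\<lambda>j. \<Sum>\<nu>\<le>l2. tvec \<nu> (\<gamma> \<nu>) j)"

definition supported :: "nat set \<Rightarrow> (nat \<Rightarrow> 'a) \<Rightarrow> bool" where
  "supported I \<gamma> \<longleftrightarrow> (\<forall>\<nu>. \<nu> \<notin> I \<longrightarrow> \<gamma> \<nu> = 0)"

definition tcode :: "nat set \<Rightarrow> (nat \<Rightarrow> 'a) set" where
  "tcode I = {tsum \<gamma> | \<gamma>. supported I \<gamma>}"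

lemma tvec_0 [simp]: "tvec \<nu> 0 = (\<lambda>j. 0)"
  by (simp add: tvec_def fun_eq_iff)

lemma tvec_add: "tvec \<nu> (x + y) j = tvec \<nu> x j + tvec \<nu> y j"
  by (simp add: tvec_def distrib_right tr_add)

lemma tvec_scale: "c \<in> F \<Longrightarrow> tvec \<nu> (c * x) j = c * tvec \<nu> x j"
  by (simp add: tvec_def tr_scale mult.assoc)

lemma tvec_combine: "(\<And>i. i \<in> I \<Longrightarrow> c i \<in> F) \<Longrightarrow> tvec \<nu> (\<Sum>i\<in>I. c i * x i) j = (\<Sum>i\<in>I. c i * tvec \<nu> (x i) j)"
  by (induction I rule: infinite_finite_induct) (auto simp: tvec_add tvec_scale)

lemma tvec_Fvecs: "tvec \<nu> x \<in> Fvecs F n"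
  by (simp add: tvec_def Fvecs_def tr_mem)

lemma tsum_Fvecs: "tsum \<gamma> \<in> Fvecs F n"
  using tvec_Fvecs unfolding tsum_def Fvecs_def by (auto intro!: sum_mem)

lemma tsum_add: "tsum (\<lambda>\<nu>. \<gamma> \<nu> + \<delta> \<nu>) = (\<lambda>j. tsum \<gamma> j + tsum \<delta> j)"
  by (simp add: tsum_def tvec_add sum.distrib)

lemma tsum_single: "\<mu> \<le> l2 \<Longrightarrow> tsum (\<lambda>\<nu>. if \<nu> = \<mu> then x else 0) = tvec \<mu> x"
proof -
  assume m: "\<mu> \<le> l2"
  have "tsum (\<lambda>\<nu>. if \<nu> = \<mu> then x else 0) = (\<lambda>j. \<Sum>\<nu>\<le>l2. if \<nu> = \<mu> then tvec \<mu> x j else 0)"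
    unfolding tsum_def by (intro ext sum.cong) auto
  then show ?thesis using m by simp
qed

lemma Fvecs_mem: "u \<in> Fvecs F n \<Longrightarrow> u j \<in> F"
  using zero_mem by (cases "j < n") (auto simp: Fvecs_def)

text \<open>The entries of \<open>u\<close> lie in \<open>F\<close> and pass through the trace. With
  \<open>tr_nondeg\<close>, orthogonality to all trace words of a coset amounts to the vanishing of
  one transform.\<close>

lemma dot_tvec: "u \<in> Fvecs F n \<Longrightarrow> dot (tvec \<nu> x) u = tr (x * hat u (a \<nu>))"
  unfolding dot_def hat_def sum_distrib_left tr_sum
proof (rule sum.cong[OF refl])
  fix j assume "u \<in> Fvecs F n" "j \<in> {..<n}"
  then show "tvec \<nu> x j * u j = tr (x * (u j * \<beta> j ^ a \<nu>))"
    using tr_scale[of "u j" "x * \<beta> j ^ a \<nu>"] Fvecs_mem[of u j] by (simp add: tvec_def mult_ac)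
qed

text \<open>Over \<open>F\<close> the transforms along a coset are conjugate, so a zero at the
  representative spreads to the whole coset.\<close>

lemma hat_frob: "u \<in> Fvecs F n \<Longrightarrow> hat u (i * q ^ t) = hat u i ^ (q ^ t)"
  unfolding hat_def frob_sum
  by (rule sum.cong) (simp_all add: power_mult_distrib F_pow Fvecs_mem power_mult)

lemma hat_mod: "hat u (i mod n) = hat u i"
  unfolding hat_def by (rule sum.cong) (simp_all add: pow_mod_n beta_nz)

text \<open>Expanding the trace leaves power sums, which survive only at exponents divisible by
  \<open>n\<close>.\<close>

lemma hat_tvec: "hat (tvec \<nu> x) i = (\<Sum>l<r. if n dvd a \<nu> * q ^ l + i then - (x ^ (q ^ l)) else 0)"
proof -
  have "hat (tvec \<nu> x) i = (\<Sum>j<n. \<Sum>l<r. x ^ (q ^ l) * \<beta> j ^ (a \<nu> * q ^ l + i))"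
    unfolding hat_def
    by (rule sum.cong) (simp_all add: tvec_def tr_def power_mult_distrib power_mult power_add sum_distrib_right mult.assoc)
  also have "\<dots> = (\<Sum>l<r. x ^ (q ^ l) * (\<Sum>j<n. \<beta> j ^ (a \<nu> * q ^ l + i)))"
    by (subst sum.swap) (simp add: sum_distrib_left)
  also have "\<dots> = (\<Sum>l<r. if n dvd a \<nu> * q ^ l + i then - (x ^ (q ^ l)) else 0)"
    unfolding power_sum by (rule sum.cong) auto
  finally show ?thesis .
qed

text \<open>A nonzero value needs opposite exponents, which \<open>opposite_exponents\<close>
  confines to the cosets of 0 and of \<open>Q - 1\<close>; in the latter only the summand
  \<open>l = r div 2\<close> survives. These values determine the hull.\<close>

lemma hat_tvec_low:
  assumes "\<mu> \<le> l2" "\<nu> \<le> l2"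
  shows "hat (tvec \<nu> x) (a \<mu>) = (if \<nu> = \<mu> then if \<mu> = 0 then - tr x else if \<mu> = l2 then - (x ^ Q) else 0 else 0)"
proof -
  consider (z) "\<mu> = 0" "\<nu> = 0" | (t) "\<mu> = l2" "\<nu> = l2" "\<mu> \<noteq> 0" | (neither) "\<not> (\<mu> = 0 \<and> \<nu> = 0)" "\<not> (\<mu> = l2 \<and> \<nu> = l2)"
    by blast
  then show ?thesis
  proof cases
    case z
    then show ?thesis by (simp add: hat_tvec a_0 tr_def sum_negf)
  next
    case t
    have "n dvd (Q - 1) * q ^ l + (Q - 1) \<longleftrightarrow> l = r div 2" if "l < r" for l
    proof
      assume "l = r div 2"
      then have "(Q - 1) * q ^ l + (Q - 1) = n" by (simp add: n_eq add.commute flip: Q_def)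
      then show "n dvd (Q - 1) * q ^ l + (Q - 1)" by simp
    next
      assume "n dvd (Q - 1) * q ^ l + (Q - 1)"
      then show "l = r div 2"
        using opposite_exponents[of l2 l2 l] that l1_lt_l2 by (simp add: a_l2_Q add.commute)
    qed
    then have "hat (tvec \<nu> x) (a \<mu>) = (\<Sum>l<r. if l = r div 2 then - (x ^ (q ^ l)) else 0)"
      using t by (simp add: hat_tvec a_l2_Q)
    also have "\<dots> = - (x ^ Q)" using r_pos by (simp add: Q_def)
    finally show ?thesis using t by simp
  next
    case neither
    have "\<not> n dvd a \<nu> * q ^ l + a \<mu>" if "l < r" for l
      using opposite_exponents[OF assms that] neither unfolding add.commute[of _ "a \<mu>"] by blast
    then have "hat (tvec \<nu> x) (a \<mu>) = 0" by (simp add: hat_tvec)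
    then show ?thesis using neither by auto
  qed
qed

text \<open>Evaluation at the opposite exponent recovers the parameter: distinct cosets do not
  interfere, and in a coset of full size only \<open>l = 0\<close> contributes. At 0 all
  \<open>r\<close> summands contribute, which leaves the trace.\<close>

lemma hat_tvec_neg:
  assumes "\<mu> \<le> l2" "\<nu> \<le> l2"
  shows "hat (tvec \<nu> x) (n - a \<mu>) = (if \<nu> = \<mu> then if \<mu> = 0 then - tr x else - x else 0)"
proof -
  have eq: "hat (tvec \<nu> x) (n - a \<mu>) = (\<Sum>l<r. if [a \<nu> * q ^ l = a \<mu>] (mod n) then - (x ^ (q ^ l)) else 0)"
    unfolding hat_tvec dvd_neg_iff[OF assms(1)] ..
  consider "\<nu> \<noteq> \<mu>" | "\<nu> = \<mu>" "\<mu> = 0" | "\<nu> = \<mu>" "0 < \<mu>" by blast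
  then show ?thesis
  proof cases
    case 1
    have "\<not> [a \<nu> * q ^ l = a \<mu>] (mod n)" for l
      using a_disj[OF assms, of l] 1 unfolding n_eq_p q_pow_p by blast
    then show ?thesis using 1 by (simp add: eq)
  next
    case 2
    then have "hat (tvec \<nu> x) (n - a \<mu>) = - tr x"
      unfolding eq by (simp add: a_0 tr_def sum_negf)
    then show ?thesis using 2 by simp
  next
    case 3
    have "[a \<nu> * q ^ l = a \<mu>] (mod n) \<longleftrightarrow> l = 0" if "l < r" for l
      using coset_full[of \<mu> l] that 3 assms by auto
    then have "hat (tvec \<nu> x) (n - a \<mu>) = (\<Sum>l<r. if l = 0 then - x else 0)"
      unfolding eq by (intro sum.cong) auto
    then show ?thesis using 3 r_pos by simp
  qed
qed

lemma hat_tsum: "hat (tsum \<gamma>) i = (\<Sum>\<nu>\<le>l2. hat (tvec \<nu> (\<gamma> \<nu>)) i)"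
  unfolding hat_def tsum_def sum_distrib_right by (rule sum.swap)

lemma hat_tsum_low:
  assumes "\<mu> \<le> l2"
  shows "hat (tsum \<gamma>) (a \<mu>) = (if \<mu> = 0 then - tr (\<gamma> 0) else if \<mu> = l2 then - (\<gamma> l2 ^ Q) else 0)"
proof -
  have "hat (tsum \<gamma>) (a \<mu>) = (\<Sum>\<nu>\<le>l2. if \<nu> = \<mu> then if \<mu> = 0 then - tr (\<gamma> 0) else if \<mu> = l2 then - (\<gamma> l2 ^ Q) else 0 else 0)"
    unfolding hat_tsum by (rule sum.cong) (use assms in \<open>auto simp: hat_tvec_low\<close>)
  then show ?thesis using assms by simp
qed

lemma hat_tsum_neg:
  assumes "\<mu> \<le> l2"
  shows "hat (tsum \<gamma>) (n - a \<mu>) = (if \<mu> = 0 then - tr (\<gamma> 0) else - \<gamma> \<mu>)"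
proof -
  have "hat (tsum \<gamma>) (n - a \<mu>) = (\<Sum>\<nu>\<le>l2. if \<nu> = \<mu> then if \<mu> = 0 then - tr (\<gamma> 0) else - \<gamma> \<mu> else 0)"
    unfolding hat_tsum by (rule sum.cong) (use assms in \<open>auto simp: hat_tvec_neg\<close>)
  then show ?thesis using assms by simp
qed

lemma tsum_eqD:
  assumes "tsum \<gamma> = tsum \<delta>"
  shows "0 < \<nu> \<Longrightarrow> \<nu> \<le> l2 \<Longrightarrow> \<gamma> \<nu> = \<delta> \<nu>" "tr (\<gamma> 0) = tr (\<delta> 0)"
  using hat_tsum_neg[of \<nu> \<gamma>] hat_tsum_neg[of \<nu> \<delta>] hat_tsum_neg[of 0 \<gamma>] hat_tsum_neg[of 0 \<delta>] assms by auto

lemma tsum_cong: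
  assumes "\<And>\<nu>. 0 < \<nu> \<Longrightarrow> \<nu> \<le> l2 \<Longrightarrow> \<gamma> \<nu> = \<delta> \<nu>" "tr (\<gamma> 0) = tr (\<delta> 0)"
  shows "tsum \<gamma> = tsum \<delta>"
proof -
  have "tvec \<nu> (\<gamma> \<nu>) = tvec \<nu> (\<delta> \<nu>)" if "\<nu> \<le> l2" for \<nu>
    using assms(1)[of \<nu>] assms(2) that by (cases "\<nu> = 0") (auto simp: tvec_def a_0)
  then show ?thesis unfolding tsum_def by simp
qed

lemma tsum_0 [simp]: "tsum (\<lambda>_. 0) = (\<lambda>_. 0)"
  by (simp add: tsum_def)

lemma tcodeI: "supported I \<gamma> \<Longrightarrow> tsum \<gamma> \<in> tcode I"
  by (auto simp: tcode_def)

lemma tcode_add: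
  assumes "I \<inter> J = {}"
  shows "{(\<lambda>x. u x + v x) | u v. u \<in> tcode I \<and> v \<in> tcode J} = tcode (I \<union> J)"
proof (intro equalityI subsetI)
  fix w assume "w \<in> {(\<lambda>x. u x + v x) | u v. u \<in> tcode I \<and> v \<in> tcode J}"
  then obtain \<gamma> \<delta> where g: "supported I \<gamma>" "supported J \<delta>" and w: "w = (\<lambda>x. tsum \<gamma> x + tsum \<delta> x)"
    by (auto simp: tcode_def)
  show "w \<in> tcode (I \<union> J)"
    unfolding w tsum_add[symmetric] tcode_def using g
    by (intro CollectI exI[of _ "\<lambda>\<nu>. \<gamma> \<nu> + \<delta> \<nu>"] conjI refl) (auto simp: supported_def)
next
  fix w assume "w \<in> tcode (I \<union> J)"
  then obtain \<gamma> where g: "supported (I \<union> J) \<gamma>" and w: "w = tsum \<gamma>" by (auto simp: tcode_def)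
  let ?\<gamma> = "\<lambda>\<nu>. if \<nu> \<in> I then \<gamma> \<nu> else 0" and ?\<delta> = "\<lambda>\<nu>. if \<nu> \<in> I then 0 else \<gamma> \<nu>"
  have "w = tsum (\<lambda>\<nu>. ?\<gamma> \<nu> + ?\<delta> \<nu>)" unfolding w by (rule arg_cong[of _ _ tsum]) auto
  then have "w = (\<lambda>x. tsum ?\<gamma> x + tsum ?\<delta> x)" unfolding tsum_add .
  moreover have "tsum ?\<gamma> \<in> tcode I" unfolding tcode_def
    by (intro CollectI exI[of _ ?\<gamma>]) (auto simp: supported_def)
  moreover have "tsum ?\<delta> \<in> tcode J" unfolding tcode_def
    by (intro CollectI exI[of _ ?\<delta>]) (use g in \<open>auto simp: supported_def\<close>)
  ultimately show "w \<in> {(\<lambda>x. u x + v x) | u v. u \<in> tcode I \<and> v \<in> tcode J}"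
    by (intro CollectI exI[of _ "tsum ?\<gamma>"] exI[of _ "tsum ?\<delta>"]) auto
qed

lemma tcode_Int:
  assumes "I \<inter> J = {}"
  shows "tcode I \<inter> tcode J \<subseteq> {\<lambda>x. 0}"
proof
  fix u assume "u \<in> tcode I \<inter> tcode J"
  then obtain \<gamma> \<delta> where g: "supported I \<gamma>" "supported J \<delta>" and u: "u = tsum \<gamma>" "u = tsum \<delta>"
    by (auto simp: tcode_def)
  have eq: "tsum \<gamma> = tsum \<delta>" using u by simp
  have *: "\<gamma> \<nu> = 0 \<or> \<delta> \<nu> = 0" for \<nu>
    using assms g by (auto simp: supported_def)
  have "tsum \<gamma> = tsum (\<lambda>_. 0)"
  proof (rule tsum_cong)
    show "\<gamma> \<nu> = 0" if "0 < \<nu>" "\<nu> \<le> l2" for \<nu>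
      using tsum_eqD(1)[OF eq that] *[of \<nu>] by auto
    show "tr (\<gamma> 0) = tr 0"
      using tsum_eqD(2)[OF eq] *[of 0] by auto
  qed
  then show "u \<in> {\<lambda>x. 0}" by (simp add: u(1))
qed

section \<open>Generators of the codes of trace words\<close>

definition blk :: "nat \<Rightarrow> nat \<Rightarrow> (nat \<Rightarrow> 'a) list" where
  "blk lo L = map (\<lambda>i. tvec (lo + i div r) (bas (i mod r))) [0..<L * r]"

definition coeffs :: "nat \<Rightarrow> nat \<Rightarrow> (nat \<Rightarrow> 'a) \<Rightarrow> nat \<Rightarrow> 'a" where
  "coeffs lo L c \<nu> = (if \<nu> \<in> {lo..<lo + L} then \<Sum>k<r. c ((\<nu> - lo) * r + k) * bas k else 0)"

lemma length_blk [simp]: "length (blk lo L) = L * r"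
  by (simp add: blk_def)

lemma blk_Fvecs: "set (blk lo L) \<subseteq> Fvecs F n"
  by (auto simp: blk_def tvec_Fvecs)

lemma supported_coeffs: "supported {lo..<lo + L} (coeffs lo L c)"
  by (auto simp: supported_def coeffs_def)

lemma index_lt: "\<nu> < L \<Longrightarrow> k < r \<Longrightarrow> \<nu> * r + k < L * r"
proof -
  assume "\<nu> < L" "k < r"
  then have "\<nu> * r + k < Suc \<nu> * r" by simp
  also have "\<dots> \<le> L * r" using \<open>\<nu> < L\<close> by (intro mult_le_mono1) simp
  finally show ?thesis .
qed

text \<open>The factor \<open>h\<close> is 1 for combinations of the generators themselves and
  \<open>omega\<close> for combinations of the rows of \<open>A B_t\<close>.\<close>

lemma comb_tvec:
  assumes "lo + L \<le> Suc l2" and c: "\<forall>i<L * r. c i \<in> F"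
  shows "(\<Sum>i<L * r. c i * tvec (lo + i div r) (h * bas (i mod r)) x)
    = tsum (\<lambda>\<nu>. h * coeffs lo L c \<nu>) x"
proof -
  have "(\<Sum>i<L * r. c i * tvec (lo + i div r) (h * bas (i mod r)) x)
      = (\<Sum>i<L * r. c ((i div r) * r + i mod r) * tvec (lo + i div r) (h * bas (i mod r)) x)"
    by simp
  also have "\<dots> = (\<Sum>\<nu><L. \<Sum>k<r. c (\<nu> * r + k) * tvec (lo + \<nu>) (h * bas k) x)"
    by (rule sum_div_mod[OF r_pos])
  also have "\<dots> = (\<Sum>\<nu><L. tvec (lo + \<nu>) (h * coeffs lo L c (lo + \<nu>)) x)"
  proof (rule sum.cong[OF refl])
    fix \<nu> assume "\<nu> \<in> {..<L}"
    then have "tvec (lo + \<nu>) (h * coeffs lo L c (lo + \<nu>)) x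
        = tvec (lo + \<nu>) (\<Sum>k<r. c (\<nu> * r + k) * (h * bas k)) x"
      by (simp add: coeffs_def sum_distrib_left mult_ac)
    also have "\<dots> = (\<Sum>k<r. c (\<nu> * r + k) * tvec (lo + \<nu>) (h * bas k) x)"
      by (rule tvec_combine) (use c \<open>\<nu> \<in> {..<L}\<close> in \<open>auto intro: index_lt\<close>)
    finally show "(\<Sum>k<r. c (\<nu> * r + k) * tvec (lo + \<nu>) (h * bas k) x)
        = tvec (lo + \<nu>) (h * coeffs lo L c (lo + \<nu>)) x" by simp
  qed
  also have "\<dots> = (\<Sum>\<nu>\<in>{lo..<lo + L}. tvec \<nu> (h * coeffs lo L c \<nu>) x)"
    by (rule sum.reindex_bij_witness[of _ "\<lambda>\<nu>. \<nu> - lo" "\<lambda>\<nu>. lo + \<nu>"]) auto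
  also have "\<dots> = (\<Sum>\<nu>\<le>l2. tvec \<nu> (h * coeffs lo L c \<nu>) x)"
    by (rule sum.mono_neutral_left) (use assms(1) in \<open>auto simp: coeffs_def\<close>)
  finally show ?thesis by (simp add: tsum_def)
qed

lemma comb_blk:
  assumes "lo + L \<le> Suc l2" and "\<forall>i<L * r. c i \<in> F"
  shows "(\<lambda>x. \<Sum>i<L * r. c i * (blk lo L ! i) x) = tsum (coeffs lo L c)"
  using comb_tvec[OF assms, of 1] by (auto simp: blk_def fun_eq_iff)

lemma coeffs_surj:
  assumes "supported {lo..<lo + L} \<gamma>"
  obtains c where "\<forall>i<L * r. c i \<in> F" "coeffs lo L c = \<gamma>"
proof
  let ?c = "\<lambda>i. coord (\<gamma> (lo + i div r)) (i mod r)"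
  show "\<forall>i<L * r. ?c i \<in> F" using r_pos by (auto intro: coord_mem)
  show "coeffs lo L ?c = \<gamma>"
  proof
    fix \<nu>
    have "coeffs lo L ?c \<nu> = (\<Sum>k<r. coord (\<gamma> \<nu>) k * bas k)" if "\<nu> \<in> {lo..<lo + L}"
      using that by (auto simp: coeffs_def intro!: sum.cong)
    then show "coeffs lo L ?c \<nu> = \<gamma> \<nu>"
      using assms by (auto simp: coord_sum supported_def coeffs_def)
  qed
qed

lemma rowspace_blk:
  assumes "lo + L \<le> Suc l2"
  shows "rowspace F (blk lo L) = tcode {lo..<lo + L}"
proof (intro equalityI subsetI)
  fix v assume "v \<in> rowspace F (blk lo L)"
  then obtain c where "\<forall>i<L * r. c i \<in> F" "v = (\<lambda>x. \<Sum>i<L * r. c i * (blk lo L ! i) x)"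
    by (auto simp: rowspace_def)
  then show "v \<in> tcode {lo..<lo + L}"
    using comb_blk[OF assms] supported_coeffs by (auto simp: tcode_def)
next
  fix v assume "v \<in> tcode {lo..<lo + L}"
  then obtain \<gamma> where g: "supported {lo..<lo + L} \<gamma>" "v = tsum \<gamma>" by (auto simp: tcode_def)
  then obtain c where c: "\<forall>i<L * r. c i \<in> F" "coeffs lo L c = \<gamma>" using coeffs_surj by blast
  have "v = (\<lambda>x. \<Sum>i<length (blk lo L). c i * (blk lo L ! i) x)"
    unfolding length_blk comb_blk[OF assms c(1)] by (simp add: g c)
  then show "v \<in> rowspace F (blk lo L)" using rowspaceI[of "blk lo L" c F] c(1) by simp
qed

text \<open>A vanishing combination has vanishing field parameters, whose coordinates in
  \<open>bas\<close> are the coefficients. With \<open>lo = 0\<close> this fails, the first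
  \<open>r\<close> rows being multiples of the all-ones word.\<close>

lemma lin_indep_blk:
  assumes "0 < lo" "lo + L \<le> Suc l2"
  shows "lin_indep_rows F (blk lo L)"
  unfolding lin_indep_rows_def length_blk
proof (intro allI impI)
  fix c i assume c: "(\<forall>i<L * r. c i \<in> F) \<and> (\<lambda>x. \<Sum>i<L * r. c i * (blk lo L ! i) x) = (\<lambda>x. 0)"
    and i: "i < L * r"
  have cF: "\<forall>i<L * r. c i \<in> F" using c by blast
  have tsum: "tsum (coeffs lo L c) = tsum (\<lambda>_. 0)" using c comb_blk[OF assms(2) cF] by simp
  have d: "i div r < L" using i by (simp add: less_mult_imp_div_less)
  then have "coeffs lo L c (lo + i div r) = 0"
    using tsum_eqD(1)[OF tsum, of "lo + i div r"] assms by simp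
  then have "(\<Sum>k<r. c (i div r * r + k) * bas k) = 0" using d by (simp add: coeffs_def)
  then have "c (i div r * r + i mod r) = 0"
    by (rule bas_indep[rotated]) (use r_pos cF d in \<open>auto intro: index_lt\<close>)
  then show "c i = 0" by simp
qed

definition one_vec :: "nat \<Rightarrow> 'a" where
  "one_vec = (\<lambda>j. if j < n then 1 else 0)"

lemma tvec_0_eq: "tvec 0 x = (\<lambda>j. tr x * one_vec j)"
  by (auto simp: tvec_def one_vec_def a_0)

lemma rowspace_one: "rowspace F [one_vec] = tcode {0}"
proof (intro equalityI subsetI)
  fix v assume "v \<in> rowspace F [one_vec]"
  then obtain c where c: "c \<in> F" "v = (\<lambda>j. c * one_vec j)" by (auto simp: rowspace_def)
  obtain x where x: "tr x = c" using tr_surj[OF c(1)] by blast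
  have "v = tsum (\<lambda>\<nu>. if \<nu> = 0 then x else 0)"
    using tsum_single[of 0 x] c x by (simp add: tvec_0_eq)
  then show "v \<in> tcode {0}" unfolding tcode_def supported_def
    by (intro CollectI exI[of _ "\<lambda>\<nu>. if \<nu> = 0 then x else 0"]) auto
next
  fix v assume "v \<in> tcode {0}"
  then obtain \<gamma> where g: "supported {0} \<gamma>" "v = tsum \<gamma>" by (auto simp: tcode_def)
  then have "\<gamma> = (\<lambda>\<nu>. if \<nu> = 0 then \<gamma> 0 else 0)" by (auto simp: supported_def)
  then have "v = tvec 0 (\<gamma> 0)" using tsum_single[of 0 "\<gamma> 0"] g by simp
  then show "v \<in> rowspace F [one_vec]"
    unfolding rowspace_def tvec_0_eq by (auto intro!: exI[of _ "\<lambda>_. tr (\<gamma> 0)"] simp: tr_mem)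
qed

lemma lin_indep_one: "lin_indep_rows F [one_vec]"
  unfolding lin_indep_rows_def using n_pos by (auto simp: one_vec_def fun_eq_iff dest!: spec[of _ 0])

text \<open>The coset of 0 contributes a single dimension, hence \<open>one_vec\<close> in front of
  the full blocks for the cosets 1 to \<open>l1\<close>.\<close>

definition "rs = one_vec # blk 1 l1"
definition "ts = blk (Suc l1) (l2 - l1)"

lemma rowspace_rs: "rowspace F rs = tcode {..l1}"
proof -
  have "rowspace F rs = tcode ({0} \<union> {1..<1 + l1})"
    unfolding rs_def using rowspace_append[of F "[one_vec]" "blk 1 l1"] l1_lt_l2
    by (simp add: rowspace_one rowspace_blk tcode_add)
  also have "{0} \<union> {1..<1 + l1} = {..l1}" by auto
  finally show ?thesis .
qed

lemma rowspace_ts: "rowspace F ts = tcode {l1<..l2}"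
proof -
  have "{Suc l1..<Suc l1 + (l2 - l1)} = {l1<..l2}" using l1_lt_l2 by auto
  then show ?thesis unfolding ts_def using rowspace_blk[of "Suc l1" "l2 - l1"] l1_lt_l2 by simp
qed

lemma lin_indep_rs: "lin_indep_rows F rs"
  using lin_indep_append[OF lin_indep_one lin_indep_blk[of 1 l1]] l1_lt_l2
    tcode_Int[of "{0}" "{1..<1 + l1}"]
  by (simp add: rs_def rowspace_one rowspace_blk)

lemma lin_indep_ts: "lin_indep_rows F ts"
  unfolding ts_def using l1_lt_l2 by (intro lin_indep_blk) auto

lemma rs_Fvecs: "set rs \<subseteq> Fvecs F n"
  using blk_Fvecs one_mem by (auto simp: rs_def one_vec_def Fvecs_def)

lemma ts_Fvecs: "set ts \<subseteq> Fvecs F n"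
  by (simp add: ts_def blk_Fvecs)

section \<open>The matrix of multiplication by \<open>omega\<close>\<close>

definition Amat :: "nat \<Rightarrow> 'a mat" where
  "Amat L = mat (L * r) (L * r) (\<lambda>(i, j).
     if i div r = j div r then coord (omega * bas (i mod r)) (j mod r) else 0)"

lemma Amat_carrier: "Amat L \<in> carrier_mat (L * r) (L * r)"
  by (simp add: Amat_def)

lemma sum_Amat:
  assumes "i < L * r"
  shows "(\<Sum>j<L * r. Amat L $$ (i, j) * w (j div r) (j mod r))
    = (\<Sum>k<r. coord (omega * bas (i mod r)) k * w (i div r) k)"
proof -
  have d: "i div r < L" using assms by (simp add: less_mult_imp_div_less)
  have "(\<Sum>j<L * r. Amat L $$ (i, j) * w (j div r) (j mod r))
      = (\<Sum>j<L * r. (if i div r = j div r then coord (omega * bas (i mod r)) (j mod r) else 0) * w (j div r) (j mod r))"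
    by (rule sum.cong) (use assms in \<open>simp_all add: Amat_def\<close>)
  also have "\<dots> = (\<Sum>\<nu><L. \<Sum>k<r. (if i div r = \<nu> then coord (omega * bas (i mod r)) k else 0) * w \<nu> k)"
    by (rule sum_div_mod[OF r_pos])
  also have "\<dots> = (\<Sum>\<nu><L. if i div r = \<nu> then \<Sum>k<r. coord (omega * bas (i mod r)) k * w \<nu> k else 0)"
    by (rule sum.cong) auto
  finally show ?thesis using d by simp
qed

text \<open>Row \<open>i\<close> of \<open>Amat\<close> holds the coordinates of
  \<open>omega\<close> times the basis element of generator \<open>i\<close>, so that multiplying
  the generators by it from the left scales their parameters by \<open>omega\<close>.\<close>

lemma Amat_blk:
  assumes "i < L * r"
  shows "(\<Sum>j<L * r. Amat L $$ (i, j) * (blk lo L ! j) x) = tvec (lo + i div r) (omega * bas (i mod r)) x"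
proof -
  have "(\<Sum>j<L * r. Amat L $$ (i, j) * (blk lo L ! j) x)
      = (\<Sum>j<L * r. Amat L $$ (i, j) * tvec (lo + j div r) (bas (j mod r)) x)"
    by (simp add: blk_def)
  also have "\<dots> = (\<Sum>k<r. coord (omega * bas (i mod r)) k * tvec (lo + i div r) (bas k) x)"
    by (rule sum_Amat[OF assms, of "\<lambda>\<nu> k. tvec (lo + \<nu>) (bas k) x"])
  also have "\<dots> = tvec (lo + i div r) (\<Sum>k<r. coord (omega * bas (i mod r)) k * bas k) x"
    by (rule tvec_combine[symmetric]) (simp add: coord_mem)
  finally show ?thesis by (simp add: coord_sum)
qed

lemma Amat_mem: "i < L * r \<Longrightarrow> j < L * r \<Longrightarrow> Amat L $$ (i, j) \<in> F"
  using r_pos zero_mem by (simp add: Amat_def coord_mem)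

text \<open>An eigenvector \<open>v\<close> of a block with eigenvalue \<open>e\<close> is an \<open>F\<close>-linear map \<open>\<phi>\<close>
  with \<open>\<phi> (omega * x) = e * \<phi> x\<close>, so \<open>\<phi>\<close> kills the multiples of \<open>omega - e \<noteq> 0\<close>.\<close>

lemma Amat_eigenvalue:
  assumes e: "e \<in> F"
  shows "\<not> eigenvalue (Amat L) e"
proof
  assume "eigenvalue (Amat L) e"
  then obtain v where v: "v \<in> carrier_vec (L * r)" "v \<noteq> 0\<^sub>v (L * r)" "Amat L *\<^sub>v v = e \<cdot>\<^sub>v v"
    unfolding eigenvalue_def eigenvector_def by (auto simp: Amat_def)
  define \<phi> where "\<phi> \<nu> x = (\<Sum>k<r. coord x k * v $ (\<nu> * r + k))" for \<nu> x
  have omega_bas: "\<phi> \<nu> (omega * bas k) = e * v $ (\<nu> * r + k)" if "\<nu> < L" "k < r" for \<nu> k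
  proof -
    let ?i = "\<nu> * r + k"
    have i: "?i < L * r" using index_lt[OF that] .
    have "e * v $ ?i = (Amat L *\<^sub>v v) $ ?i" using v i by simp
    also have "\<dots> = (\<Sum>j<L * r. Amat L $$ (?i, j) * v $ j)"
      using i v(1) Amat_carrier[of L] by (simp add: scalar_prod_def lessThan_atLeast0)
    also have "\<dots> = (\<Sum>j<L * r. Amat L $$ (?i, j) * (\<lambda>\<nu> k. v $ (\<nu> * r + k)) (j div r) (j mod r))"
      by simp
    also have "\<dots> = (\<Sum>j<r. coord (omega * bas (?i mod r)) j * v $ ((?i div r) * r + j))"
      by (rule sum_Amat[OF i])
    finally show ?thesis using that by (simp add: \<phi>_def)
  qed
  have combine: "\<phi> \<nu> (\<Sum>i\<in>I. a i * x i) = (\<Sum>i\<in>I. a i * \<phi> \<nu> (x i))"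
    if "\<And>i. i \<in> I \<Longrightarrow> a i \<in> F" for \<nu> a x and I :: "nat set"
  proof -
    have "\<phi> \<nu> (\<Sum>i\<in>I. a i * x i) = (\<Sum>k<r. \<Sum>i\<in>I. a i * coord (x i) k * v $ (\<nu> * r + k))"
      unfolding \<phi>_def by (rule sum.cong) (simp_all add: coord_combine that sum_distrib_right)
    also have "\<dots> = (\<Sum>i\<in>I. a i * \<phi> \<nu> (x i))"
      unfolding \<phi>_def by (subst sum.swap) (simp add: sum_distrib_left mult.assoc)
    finally show ?thesis .
  qed
  have eig: "\<phi> \<nu> (omega * x) = e * \<phi> \<nu> x" if "\<nu> < L" for \<nu> x
  proof -
    have "omega * x = (\<Sum>k<r. coord x k * (omega * bas k))"
      by (subst (1) coord_sum[of x, symmetric]) (simp add: sum_distrib_left mult_ac)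
    then have "\<phi> \<nu> (omega * x) = (\<Sum>k<r. coord x k * \<phi> \<nu> (omega * bas k))"
      using combine[of "{..<r}" "coord x" \<nu> "\<lambda>k. omega * bas k"] by (simp add: coord_mem)
    also have "\<dots> = e * \<phi> \<nu> x"
      unfolding \<phi>_def[of \<nu> x] sum_distrib_left by (rule sum.cong) (use that in \<open>simp_all add: omega_bas\<close>)
    finally show ?thesis .
  qed
  have zero: "\<phi> \<nu> x = 0" if "\<nu> < L" for \<nu> x
  proof -
    let ?y = "x / (omega - e)"
    have ne: "omega - e \<noteq> 0" using e omega_notin_F by auto
    have "\<phi> \<nu> (omega * ?y + (- e) * ?y) = \<phi> \<nu> (omega * ?y) + (- e) * \<phi> \<nu> ?y"
      using combine[of "{0, 1}" "\<lambda>i. if i = 0 then 1 else - e" \<nu> "\<lambda>i. if i = 0 then omega * ?y else ?y"]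
        one_mem minus_mem[OF e] by simp
    also have "\<dots> = 0" unfolding eig[OF that] by simp
    also have "omega * ?y + (- e) * ?y = x"
      using ne by (simp add: divide_simps) (simp add: algebra_simps)
    finally show ?thesis .
  qed
  have "v $ i = 0" if i: "i < L * r" for i
  proof -
    have d: "i div r < L" "i mod r < r" using i r_pos by (simp_all add: less_mult_imp_div_less)
    have "coord (bas (i mod r)) k = (if k = i mod r then 1 else 0)" if "k < r" for k
      by (rule coord_unique) (use that d zero_mem one_mem in \<open>auto simp: if_distrib[of "\<lambda>y. y * _"] cong: if_cong\<close>)
    then have "\<phi> (i div r) (bas (i mod r)) = (\<Sum>k<r. (if k = i mod r then 1 else 0) * v $ (i div r * r + k))"
      unfolding \<phi>_def by (intro sum.cong) auto
    also have "\<dots> = v $ i" using d by (simp add: if_distrib[of "\<lambda>y. y * _"] cong: if_cong)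
    finally show ?thesis using zero[OF d(1)] by simp
  qed
  then have "v = 0\<^sub>v (L * r)" using v(1) by (intro eq_vecI) auto
  then show False using v(2) by simp
qed

text \<open>A kernel vector would be an eigenvector for 0, and 0 lies in \<open>F\<close>.\<close>

lemma Amat_invertible: "invertible_mat (Amat L)"
proof -
  have "det (Amat L) \<noteq> 0"
  proof
    assume "det (Amat L) = 0"
    then obtain v where "v \<in> carrier_vec (L * r)" "v \<noteq> 0\<^sub>v (L * r)" "Amat L *\<^sub>v v = 0\<^sub>v (L * r)"
      using det_0_iff_vec_prod_zero[OF Amat_carrier] by blast
    then have "eigenvector (Amat L) v 0"
      using Amat_carrier[of L] unfolding eigenvector_def by auto
    then show False using Amat_eigenvalue[OF zero_mem] unfolding eigenvalue_def by blast
  qed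
  then obtain B where "B \<in> carrier_mat (L * r) (L * r)" "B * Amat L = 1\<^sub>m (L * r)" "Amat L * B = 1\<^sub>m (L * r)"
    using det_non_zero_imp_unit[OF Amat_carrier, of L "()"]
    by (auto simp: Units_def ring_mat_simps)
  then show ?thesis using Amat_carrier[of L]
    unfolding invertible_mat_def inverts_mat_def by (auto intro!: exI[of _ B])
qed

text \<open>Stated for general \<open>I\<close>, \<open>lo\<close> and \<open>L\<close> because it
  serves both the enlarged code and its hull. Over \<open>I\<close> the two families of parameters
  are independent, over the block they are tied by \<open>omega\<close>.\<close>

lemma steane_code_blk:
  assumes I: "rowspace F rs' = tcode I" "I \<inter> {lo..<lo + L} = {}" and lo: "lo + L \<le> Suc l2"
  shows "steane_code F n rs' (blk lo L) (Amat L) =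
    {pairv n (tsum \<gamma>) (tsum \<delta>) | \<gamma> \<delta>. supported (I \<union> {lo..<lo + L}) \<gamma> \<and>
       supported (I \<union> {lo..<lo + L}) \<delta> \<and> (\<forall>\<nu>\<in>{lo..<lo + L}. \<delta> \<nu> = omega * \<gamma> \<nu>)}"
    (is "_ = ?R")
proof -
  let ?J = "{lo..<lo + L}"
  have comb: "(\<Sum>i<L * r. c i * (\<Sum>j<L * r. Amat L $$ (i, j) * (blk lo L ! j) x))
      = tsum (\<lambda>\<nu>. omega * coeffs lo L c \<nu>) x" if "\<forall>i<L * r. c i \<in> F" for c x
    using comb_tvec[OF lo that, of omega x] by (simp add: Amat_blk)
  have comb1: "(\<Sum>i<L * r. c i * (blk lo L ! i) x) = tsum (coeffs lo L c) x" if "\<forall>i<L * r. c i \<in> F" for c x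
    using fun_cong[OF comb_blk[OF lo that], of x] .
  show ?thesis
  proof (intro equalityI subsetI)
    fix z assume "z \<in> steane_code F n rs' (blk lo L) (Amat L)"
    then obtain c \<rho> \<rho>' where c: "\<forall>i<L * r. c i \<in> F" and r: "\<rho> \<in> tcode I" "\<rho>' \<in> tcode I"
      and z: "z = pairv n (\<lambda>x. tsum (coeffs lo L c) x + \<rho> x) (\<lambda>x. tsum (\<lambda>\<nu>. omega * coeffs lo L c \<nu>) x + \<rho>' x)"
      unfolding steane_code_eq length_blk I(1) using comb comb1
      by (elim CollectE exE conjE) simp
    from r obtain \<gamma> \<delta> where g: "supported I \<gamma>" "\<rho> = tsum \<gamma>" "supported I \<delta>" "\<rho>' = tsum \<delta>"
      by (auto simp: tcode_def)
    have J: "coeffs lo L c \<nu> = 0" if "\<nu> \<notin> ?J" for \<nu>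
      using supported_coeffs that by (simp add: supported_def)
    have I0: "\<gamma> \<nu> = 0" "\<delta> \<nu> = 0" if "\<nu> \<in> ?J" for \<nu>
      using g I(2) that by (auto simp: supported_def)
    have s: "supported (I \<union> ?J) (\<lambda>\<nu>. coeffs lo L c \<nu> + \<gamma> \<nu>)"
      "supported (I \<union> ?J) (\<lambda>\<nu>. omega * coeffs lo L c \<nu> + \<delta> \<nu>)"
      using g J by (auto simp: supported_def)
    show "z \<in> ?R"
      unfolding z g tsum_add[symmetric]
      by (intro CollectI exI conjI, rule refl) (use s I0 in auto)
  next
    fix z assume "z \<in> ?R"
    then obtain \<gamma> \<delta> where z: "z = pairv n (tsum \<gamma>) (tsum \<delta>)" and s: "supported (I \<union> ?J) \<gamma>" "supported (I \<union> ?J) \<delta>"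
      and w: "\<forall>\<nu>\<in>?J. \<delta> \<nu> = omega * \<gamma> \<nu>" by blast
    let ?\<gamma>J = "\<lambda>\<nu>. if \<nu> \<in> ?J then \<gamma> \<nu> else 0"
    let ?\<gamma>I = "\<lambda>\<nu>. if \<nu> \<in> ?J then 0 else \<gamma> \<nu>" and ?\<delta>I = "\<lambda>\<nu>. if \<nu> \<in> ?J then 0 else \<delta> \<nu>"
    have "supported ?J ?\<gamma>J" by (simp add: supported_def)
    then obtain c where c: "\<forall>i<L * r. c i \<in> F" "coeffs lo L c = ?\<gamma>J" by (rule coeffs_surj)
    have e1: "tsum \<gamma> = (\<lambda>x. tsum (coeffs lo L c) x + tsum ?\<gamma>I x)"
      unfolding c(2) tsum_add[symmetric] by (rule arg_cong[of _ _ tsum]) auto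
    have e2: "tsum \<delta> = (\<lambda>x. tsum (\<lambda>\<nu>. omega * coeffs lo L c \<nu>) x + tsum ?\<delta>I x)"
      unfolding c(2) tsum_add[symmetric] by (rule arg_cong[of _ _ tsum]) (use w in auto)
    have tI: "tsum ?\<gamma>I \<in> tcode I" "tsum ?\<delta>I \<in> tcode I"
      using s by (auto simp: supported_def intro!: tcodeI)
    show "z \<in> steane_code F n rs' (blk lo L) (Amat L)"
      unfolding steane_code_eq length_blk I(1) z e1 e2 comb[OF c(1), symmetric] comb1[OF c(1), symmetric]
      by (intro CollectI exI conjI, rule refl) (use c(1) tI in auto)
  qed
qed

section \<open>The enlarged code, its symplectic dual and its hull\<close>

definition S :: "(nat \<Rightarrow> 'a) set" where
  "S = steane_code F n rs ts (Amat (l2 - l1))"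

lemma S_eq: "S = {pairv n (tsum \<gamma>) (tsum \<delta>) | \<gamma> \<delta>. supported {..l2} \<gamma> \<and> supported {..l2} \<delta> \<and>
    (\<forall>\<nu>\<in>{l1<..l2}. \<delta> \<nu> = omega * \<gamma> \<nu>)}"
proof -
  have J: "{Suc l1..<Suc l1 + (l2 - l1)} = {l1<..l2}" using l1_lt_l2 by auto
  have "{..l1} \<union> {l1<..l2} = {..l2}" using l1_lt_l2 by auto
  moreover have "{..l1} \<inter> {l1<..l2} = {}" by auto
  ultimately show ?thesis
    using steane_code_blk[OF rowspace_rs, of "Suc l1" "l2 - l1"] l1_lt_l2 unfolding S_def ts_def J by simp
qed

lemma pairv_Fvecs_eqD:
  assumes "pairv n u v = pairv n u' v'" "u \<in> Fvecs F n" "u' \<in> Fvecs F n"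
  shows "u = u'" "v = v'"
  using pairv_eqD1[OF assms(1)] pairv_eqD2[OF assms(1)] assms(2,3) by (auto simp: Fvecs_def)

lemma dot_tsum: "u \<in> Fvecs F n \<Longrightarrow> dot (tsum \<gamma>) u = (\<Sum>\<nu>\<le>l2. tr (\<gamma> \<nu> * hat u (a \<nu>)))"
proof -
  assume u: "u \<in> Fvecs F n"
  have "dot (tsum \<gamma>) u = (\<Sum>\<nu>\<le>l2. dot (tvec \<nu> (\<gamma> \<nu>)) u)"
    unfolding dot_def tsum_def sum_distrib_right by (rule sum.swap)
  then show ?thesis by (simp add: dot_tvec[OF u])
qed

lemma symp_tsum:
  assumes "u \<in> Fvecs F n" "v \<in> Fvecs F n"
  shows "symp n (pairv n (tsum \<gamma>) (tsum \<delta>)) (pairv n u v)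
    = (\<Sum>\<nu>\<le>l2. tr (\<gamma> \<nu> * hat v (a \<nu>) - \<delta> \<nu> * hat u (a \<nu>)))"
proof -
  have "symp n (pairv n (tsum \<gamma>) (tsum \<delta>)) (pairv n u v) = dot (tsum \<gamma>) v - dot (tsum \<delta>) u"
    by (simp add: symp_def pairv_def dot_def sum_subtractf)
  also have "\<dots> = (\<Sum>\<nu>\<le>l2. tr (\<gamma> \<nu> * hat v (a \<nu>)) + tr (- (\<delta> \<nu> * hat u (a \<nu>))))"
    by (simp add: dot_tsum assms tr_minus sum_subtractf)
  finally show ?thesis by (simp flip: tr_add)
qed

text \<open>Testing against parameters supported on a single coset isolates the conditions, and
  \<open>tr_nondeg\<close> strips the trace from each.\<close>

lemma symp_dual_S:
  assumes uv: "u \<in> Fvecs F n" "v \<in> Fvecs F n"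
  shows "pairv n u v \<in> symp_dual F n S \<longleftrightarrow>
    (\<forall>\<mu>\<le>l1. hat u (a \<mu>) = 0 \<and> hat v (a \<mu>) = 0) \<and>
    (\<forall>\<mu>\<in>{l1<..l2}. hat v (a \<mu>) = omega * hat u (a \<mu>))" (is "?L \<longleftrightarrow> ?R")
proof
  assume L: ?L
  have orth: "(\<Sum>\<nu>\<le>l2. tr (\<gamma> \<nu> * hat v (a \<nu>) - \<delta> \<nu> * hat u (a \<nu>))) = 0"
    if "supported {..l2} \<gamma>" "supported {..l2} \<delta>" "\<forall>\<nu>\<in>{l1<..l2}. \<delta> \<nu> = omega * \<gamma> \<nu>" for \<gamma> \<delta>
  proof -
    have "pairv n (tsum \<gamma>) (tsum \<delta>) \<in> S" unfolding S_eq using that by blast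
    then show ?thesis using L unfolding symp_tsum[OF uv, symmetric] symp_dual_def by blast
  qed
  have single: "tr (x * hat v (a \<mu>) - y * hat u (a \<mu>)) = 0"
    if \<mu>: "\<mu> \<le> l2" and xy: "\<mu> \<in> {l1<..l2} \<Longrightarrow> y = omega * x" for \<mu> x y
  proof -
    let ?\<gamma> = "\<lambda>\<nu>. if \<nu> = \<mu> then x else 0" and ?\<delta> = "\<lambda>\<nu>. if \<nu> = \<mu> then y else 0"
    have "(\<Sum>\<nu>\<le>l2. tr (?\<gamma> \<nu> * hat v (a \<nu>) - ?\<delta> \<nu> * hat u (a \<nu>))) = 0"
      by (rule orth) (use that in \<open>auto simp: supported_def\<close>)
    also have "(\<Sum>\<nu>\<le>l2. tr (?\<gamma> \<nu> * hat v (a \<nu>) - ?\<delta> \<nu> * hat u (a \<nu>)))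
        = (\<Sum>\<nu>\<le>l2. if \<nu> = \<mu> then tr (x * hat v (a \<mu>) - y * hat u (a \<mu>)) else 0)"
      by (rule sum.cong) auto
    finally show ?thesis using \<mu> by simp
  qed
  show ?R
  proof (intro conjI allI impI ballI)
    fix \<mu> assume m: "\<mu> \<le> l1"
    show "hat u (a \<mu>) = 0"
    proof (rule tr_nondeg)
      fix y show "tr (y * hat u (a \<mu>)) = 0"
        using single[of \<mu> "- y" 0] single[of \<mu> y 0] single[of \<mu> 0 "- y"] m l1_lt_l2 by simp
    qed
    show "hat v (a \<mu>) = 0"
    proof (rule tr_nondeg)
      fix y show "tr (y * hat v (a \<mu>)) = 0"
        using single[of \<mu> 0 y] m l1_lt_l2 by simp
    qed
  next
    fix \<mu> assume m: "\<mu> \<in> {l1<..l2}"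
    \<comment> \<open>On these cosets the admissible test pairs are \<open>(x, omega * x)\<close>,
      which yield the trace of \<open>x\<close> times this difference.\<close>
    have "hat v (a \<mu>) - omega * hat u (a \<mu>) = 0"
    proof (rule tr_nondeg)
      fix x show "tr (x * (hat v (a \<mu>) - omega * hat u (a \<mu>))) = 0"
        using single[of \<mu> "omega * x" x] m by (simp add: algebra_simps)
    qed
    then show "hat v (a \<mu>) = omega * hat u (a \<mu>)" by simp
  qed
next
  assume R: ?R
  have "symp n z (pairv n u v) = 0" if zS: "z \<in> S" for z
  proof -
    obtain \<gamma> \<delta> where z: "z = pairv n (tsum \<gamma>) (tsum \<delta>)" "\<forall>\<nu>\<in>{l1<..l2}. \<delta> \<nu> = omega * \<gamma> \<nu>"
      using zS unfolding S_eq by blast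
    show ?thesis unfolding z(1) symp_tsum[OF uv]
    proof (rule sum.neutral, rule ballI)
      fix \<nu> assume "\<nu> \<in> {..l2}"
      then show "tr (\<gamma> \<nu> * hat v (a \<nu>) - \<delta> \<nu> * hat u (a \<nu>)) = 0"
        using R z(2) by (cases "\<nu> \<le> l1") auto
    qed
  qed
  then show ?L using pairv_in_Fvecs[OF uv] by (simp add: symp_dual_def)
qed

text \<open>The candidate for the hull is again of Steane type, without the constants and without
  the last coset, so its dimension follows from \<open>dimF_steane_code\<close>.\<close>

definition "rad = steane_code F n (blk 1 l1) (blk (Suc l1) (l2 - Suc l1)) (Amat (l2 - Suc l1))"

lemma rad_eq: "rad = {pairv n (tsum \<gamma>) (tsum \<delta>) | \<gamma> \<delta>. supported {1..<l2} \<gamma> \<and> supported {1..<l2} \<delta> \<and>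
    (\<forall>\<nu>\<in>{Suc l1..<l2}. \<delta> \<nu> = omega * \<gamma> \<nu>)}"
proof -
  have J: "Suc l1 + (l2 - Suc l1) = l2" using l1_lt_l2 by auto
  have "{1..<1 + l1} \<union> {Suc l1..<l2} = {1..<l2}" using l1_lt_l2 by auto
  moreover have "{1..<1 + l1} \<inter> {Suc l1..<l2} = {}" by auto
  ultimately show ?thesis
    using steane_code_blk[OF rowspace_blk[of 1 l1], of "Suc l1" "l2 - Suc l1"] l1_lt_l2
    unfolding rad_def J by simp
qed

lemma rad_S: "S \<inter> symp_dual F n S = rad"
proof (intro equalityI subsetI)
  fix z assume z: "z \<in> S \<inter> symp_dual F n S"
  then obtain \<gamma> \<delta> where zG: "z = pairv n (tsum \<gamma>) (tsum \<delta>)" and w: "\<forall>\<nu>\<in>{l1<..l2}. \<delta> \<nu> = omega * \<gamma> \<nu>"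
    unfolding S_eq by blast
  have R: "\<forall>\<mu>\<le>l1. hat (tsum \<gamma>) (a \<mu>) = 0 \<and> hat (tsum \<delta>) (a \<mu>) = 0"
    "\<forall>\<mu>\<in>{l1<..l2}. hat (tsum \<delta>) (a \<mu>) = omega * hat (tsum \<gamma>) (a \<mu>)"
    using z symp_dual_S[OF tsum_Fvecs tsum_Fvecs, of \<gamma> \<delta>] zG by auto
  have tr0: "tr (\<gamma> 0) = 0" "tr (\<delta> 0) = 0"
    using R(1)[rule_format, of 0] hat_tsum_low[of 0] by auto
  \<comment> \<open>At the last coset the transforms are minus the \<open>Q\<close>-th powers of the
    parameters. With \<open>\<delta> l2 = omega * \<gamma> l2\<close>, the dual condition there
    compares \<open>omega ^ Q\<close> with \<open>omega\<close>.\<close>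
  have "(omega ^ Q - omega) * \<gamma> l2 ^ Q = 0"
    using R(2)[rule_format, of l2] hat_tsum_low[of l2] l1_lt_l2 w
    by (simp add: power_mult_distrib algebra_simps)
  then have g: "\<gamma> l2 = 0" using omega by simp
  then have d: "\<delta> l2 = 0" using w l1_lt_l2 by simp
  \<comment> \<open>The parameters at 0 have trace zero, so setting them to 0 leaves the words
    unchanged.\<close>
  let ?\<gamma> = "\<lambda>\<nu>. if \<nu> \<in> {1..<l2} then \<gamma> \<nu> else 0" and ?\<delta> = "\<lambda>\<nu>. if \<nu> \<in> {1..<l2} then \<delta> \<nu> else 0"
  have "tsum \<gamma> = tsum ?\<gamma>" by (rule tsum_cong) (use tr0 g in \<open>auto simp: le_less\<close>)
  moreover have "tsum \<delta> = tsum ?\<delta>" by (rule tsum_cong) (use tr0 d in \<open>auto simp: le_less\<close>)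
  ultimately have "z = pairv n (tsum ?\<gamma>) (tsum ?\<delta>)" using zG by simp
  then show "z \<in> rad" unfolding rad_eq
    by (intro CollectI exI[of _ ?\<gamma>] exI[of _ ?\<delta>]) (use w in \<open>auto simp: supported_def\<close>)
next
  fix z assume "z \<in> rad"
  then obtain \<gamma> \<delta> where zG: "z = pairv n (tsum \<gamma>) (tsum \<delta>)"
    and s: "supported {1..<l2} \<gamma>" "supported {1..<l2} \<delta>"
    and w: "\<forall>\<nu>\<in>{Suc l1..<l2}. \<delta> \<nu> = omega * \<gamma> \<nu>"
    unfolding rad_eq by blast
  have end0: "\<gamma> 0 = 0" "\<delta> 0 = 0" "\<gamma> l2 = 0" "\<delta> l2 = 0" using s by (auto simp: supported_def)
  have "\<delta> \<nu> = omega * \<gamma> \<nu>" if "\<nu> \<in> {l1<..l2}" for \<nu>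
    using w end0 that by (cases "\<nu> = l2") auto
  moreover have "supported {..l2} \<gamma>" "supported {..l2} \<delta>" using s by (auto simp: supported_def)
  ultimately have "z \<in> S" unfolding S_eq zG by blast
  \<comment> \<open>With the parameters at 0 and \<open>l2\<close> gone, every transform in the dual
    conditions is zero.\<close>
  moreover have "hat (tsum \<gamma>) (a \<mu>) = 0" "hat (tsum \<delta>) (a \<mu>) = 0" if "\<mu> \<le> l2" for \<mu>
    using hat_tsum_low[OF that] end0 Q_gt_1 by (simp_all add: power_0_left)
  then have "z \<in> symp_dual F n S"
    unfolding zG symp_dual_S[OF tsum_Fvecs tsum_Fvecs] using l1_lt_l2 by auto
  ultimately show "z \<in> S \<inter> symp_dual F n S" by blast
qed

lemma rs_ts_Int: "rowspace F rs \<inter> rowspace F ts \<subseteq> {\<lambda>x. 0}"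
  unfolding rowspace_rs rowspace_ts by (rule tcode_Int) auto

lemma dim_S: "dimF F S = (l2 - l1) * r + 2 * (1 + l1 * r)"
  unfolding S_def dimF_steane_code[OF lin_indep_rs lin_indep_ts rs_ts_Int rs_Fvecs ts_Fvecs]
  by (simp add: rs_def ts_def)

lemma dim_rad: "dimF F rad = (l2 - Suc l1) * r + 2 * (l1 * r)"
proof -
  have "rowspace F (blk 1 l1) \<inter> rowspace F (blk (Suc l1) (l2 - Suc l1)) \<subseteq> {\<lambda>x. 0}"
    using l1_lt_l2 tcode_Int[of "{1..<1 + l1}" "{Suc l1..<l2}"] by (simp add: rowspace_blk)
  then show ?thesis
    unfolding rad_def using l1_lt_l2
    by (subst dimF_steane_code) (auto intro!: lin_indep_blk blk_Fvecs[THEN subsetD])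
qed

lemma ea_c_S: "ea_c F n S = r div 2 + 1"
proof -
  have "l2 - l1 = Suc (l2 - Suc l1)" using l1_lt_l2 by simp
  then have "dimF F S = dimF F rad + (r + 2)" by (simp add: dim_S dim_rad)
  then show ?thesis by (simp add: ea_c_def rad_S)
qed

lemma ea_k_S: "ea_k F n S = int n - int r * int (l1 + l2) - 1 + int (r div 2)"
proof -
  have "int (l2 - l1) = int l2 - int l1" using l1_lt_l2 by simp
  then show ?thesis unfolding ea_k_def ea_c_S dim_S by (simp add: algebra_simps)
qed

section \<open>Minimum distance\<close>

lemma vandermonde_weight:
  assumes u: "\<And>j. n \<le> j \<Longrightarrow> u j = 0" "u \<noteq> (\<lambda>x. 0)" and z: "\<And>i. i < d \<Longrightarrow> hat u i = 0"
  shows "d < card {j. j < n \<and> u j \<noteq> 0}"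
proof (rule ccontr)
  let ?T = "{j. j < n \<and> u j \<noteq> 0}"
  assume "\<not> ?thesis"
  then have le: "card ?T \<le> d" by simp
  obtain j0 where j0: "u j0 \<noteq> 0" using u(2) by auto
  then have j0n: "j0 < n" using u(1) by (meson not_le)
  \<comment> \<open>This polynomial vanishes at all points of the support but one. On a support of
    at most \<open>d\<close> points its degree is below \<open>d\<close>, so the sum of
    \<open>u j * poly P (\<beta> j)\<close> is a combination of zero transforms, yet it has exactly
    one nonzero term. This replaces a Vandermonde determinant.\<close>
  define P where "P = (\<Prod>j\<in>?T - {j0}. [:- \<beta> j, 1:])"
  have "degree P = card (?T - {j0})" unfolding P_def
    by (subst degree_prod_eq_sum_degree) auto
  also have "\<dots> < card ?T" using j0 j0n by (intro psubset_card_mono) auto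
  finally have deg: "degree P < d" using le by simp
  have poly0: "poly P (\<beta> j) = 0" if "j < n" "u j \<noteq> 0" "j \<noteq> j0" for j
    using that by (auto simp: P_def poly_prod)
  have "(\<Sum>j<n. u j * poly P (\<beta> j)) = (\<Sum>j<n. \<Sum>i\<le>degree P. coeff P i * (u j * \<beta> j ^ i))"
    by (simp add: poly_altdef sum_distrib_left mult_ac)
  also have "\<dots> = (\<Sum>i\<le>degree P. coeff P i * hat u i)"
    by (subst sum.swap) (simp add: hat_def sum_distrib_left)
  also have "\<dots> = 0" using deg z by (intro sum.neutral) auto
  finally have "(\<Sum>j<n. u j * poly P (\<beta> j)) = 0" .
  moreover have "(\<Sum>j<n. u j * poly P (\<beta> j)) = (\<Sum>j<n. if j = j0 then u j0 * poly P (\<beta> j0) else 0)"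
    by (rule sum.cong) (use poly0 in auto)
  ultimately have "poly P (\<beta> j0) = 0" using j0 j0n by simp
  then obtain j where "j \<in> ?T - {j0}" "poly [:- \<beta> j, 1:] (\<beta> j0) = 0"
    unfolding P_def poly_prod by (subst (asm) prod_zero_iff) auto
  then have "j < n" "j \<noteq> j0" "\<beta> j = \<beta> j0" by auto
  then show False using bij_betw_beta_nonzero j0n by (auto simp: bij_betw_def inj_on_def)
qed

text \<open>Zeros at the representatives spread over their cosets, which by \<open>a_cover\<close>
  contain all exponents below \<open>a (Suc l)\<close>: a run of consecutive zeros.\<close>

lemma bch_bound:
  assumes u: "u \<in> Fvecs F n" "u \<noteq> (\<lambda>x. 0)" and l: "l \<le> l2" and z: "\<And>\<mu>. \<mu> \<le> l \<Longrightarrow> hat u (a \<mu>) = 0"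
  shows "a (Suc l) + 1 \<le> card {j. j < n \<and> u j \<noteq> 0}"
proof -
  have "hat u i = 0" if i: "i < a (Suc l)" for i
  proof -
    obtain \<nu> t where "\<nu> \<le> l" "i = a \<nu> * q ^ t mod n"
      using a_cover[OF l i] unfolding n_eq_p q_pow_p by blast
    then show ?thesis using hat_mod hat_frob[OF u(1)] z q_gt_1 by (simp add: power_0_left)
  qed
  then have "a (Suc l) < card {j. j < n \<and> u j \<noteq> 0}"
    by (intro vandermonde_weight) (use u in \<open>auto simp: Fvecs_def\<close>)
  then show ?thesis by simp
qed

lemma swt_pairv: "swt n (pairv n u v) = card {j. j < n \<and> (u j \<noteq> 0 \<or> v j \<noteq> 0)}"
  unfolding swt_def by (rule arg_cong[of _ _ card]) (auto simp: pairv_def)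

lemma card_eq_sum: "card {j. j < n \<and> P j} = (\<Sum>j<n. of_bool (P j))"
proof -
  have "{j. j < n \<and> P j} = {..<n} \<inter> {j. P j}" by auto
  then show ?thesis by (simp add: sum_of_bool_eq)
qed

text \<open>Double counting over the \<open>q + 1\<close> points of the projective line over \<open>F\<close>.\<close>

lemma swt_average:
  assumes u: "u \<in> Fvecs F n" and v: "v \<in> Fvecs F n"
  shows "card {j. j < n \<and> u j \<noteq> 0} + (\<Sum>c\<in>F. card {j. j < n \<and> v j - c * u j \<noteq> 0})
    = q * swt n (pairv n u v)"
proof -
  have coord: "of_bool (u j \<noteq> 0) + (\<Sum>c\<in>F. of_bool (v j - c * u j \<noteq> 0)) = q * of_bool (u j \<noteq> 0 \<or> v j \<noteq> 0)"
    for j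
  proof (cases "u j = 0")
    case True
    then show ?thesis by (simp add: card_F)
  next
    case False
    have "(\<Sum>c\<in>F. of_bool (v j - c * u j \<noteq> 0) :: nat) = card {c \<in> F. v j - c * u j \<noteq> 0}"
      by (simp add: sum_of_bool_eq Int_def)
    also have "{c \<in> F. v j - c * u j \<noteq> 0} = F - {v j / u j}" using False by auto
    also have "card \<dots> = q - 1"
      using divide_mem Fvecs_mem[OF u] Fvecs_mem[OF v] by (simp add: card_F)
    finally show ?thesis using False q_gt_1 by simp
  qed
  have "card {j. j < n \<and> u j \<noteq> 0} + (\<Sum>c\<in>F. card {j. j < n \<and> v j - c * u j \<noteq> 0})
      = (\<Sum>j<n. of_bool (u j \<noteq> 0) + (\<Sum>c\<in>F. of_bool (v j - c * u j \<noteq> 0)))"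
    unfolding card_eq_sum sum.distrib by (subst sum.swap) simp
  also have "\<dots> = q * swt n (pairv n u v)"
    unfolding coord swt_pairv card_eq_sum by (simp add: sum_distrib_left)
  finally show ?thesis .
qed

lemma hat_diff: "hat (\<lambda>x. v x - c * u x) i = hat v i - c * hat u i"
  by (simp add: hat_def algebra_simps sum_subtractf sum_distrib_left)

text \<open>A disjunction with denominators cleared keeps the argument in the natural numbers; the
  quotient and its ceiling enter in \<open>ea_d_S\<close>.\<close>

lemma swt_bound:
  assumes z: "z \<in> symp_dual F n S" "z \<noteq> (\<lambda>x. 0)"
  shows "a (Suc l2) + 1 \<le> swt n z \<or> (q + 1) * (a (Suc l1) + 1) \<le> q * swt n z"
proof -
  obtain u v where uv: "u \<in> Fvecs F n" "v \<in> Fvecs F n" and zp: "z = pairv n u v"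
    using z(1) by (auto simp: symp_dual_def elim: Fvecs_pairE)
  have low: "hat u (a \<mu>) = 0" "hat v (a \<mu>) = 0" if "\<mu> \<le> l1" for \<mu>
    using z(1) that unfolding zp symp_dual_S[OF uv] by auto
  have high: "hat v (a \<mu>) = omega * hat u (a \<mu>)" if "l1 < \<mu>" "\<mu> \<le> l2" for \<mu>
    using z(1) that unfolding zp symp_dual_S[OF uv] by auto
  have cm: "card {j. j < n \<and> w j \<noteq> 0} \<le> swt n z" if "\<And>j. w j \<noteq> 0 \<Longrightarrow> u j \<noteq> 0 \<or> v j \<noteq> 0" for w :: "nat \<Rightarrow> 'a"
    unfolding zp swt_pairv by (rule card_mono) (use that in auto)
  \<comment> \<open>Proportionality over \<open>F\<close> takes two cases, since
    \<open>u = 0\<close> with \<open>v \<noteq> 0\<close> is not of the form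
    \<open>v = c * u\<close>.\<close>
  consider (zero) "u = (\<lambda>x. 0)" | (mult) c where "u \<noteq> (\<lambda>x. 0)" "c \<in> F" "v = (\<lambda>x. c * u x)"
    | (indep) "u \<noteq> (\<lambda>x. 0)" "\<And>c. c \<in> F \<Longrightarrow> v \<noteq> (\<lambda>x. c * u x)" by blast
  then show ?thesis
  proof cases
    case zero
    have hu: "hat u i = 0" for i by (simp add: hat_def zero)
    have "v \<noteq> (\<lambda>x. 0)" using z(2) zero zp by (auto simp: pairv_zero)
    moreover have "hat v (a \<mu>) = 0" if "\<mu> \<le> l2" for \<mu>
      using low(2)[of \<mu>] high[of \<mu>] that hu by (cases "\<mu> \<le> l1") auto
    ultimately have "a (Suc l2) + 1 \<le> card {j. j < n \<and> v j \<noteq> 0}" by (intro bch_bound uv) auto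
    then show ?thesis using cm[of v] by auto
  next
    case mult
    have "hat v i = c * hat u i" for i by (simp add: mult(3) hat_def sum_distrib_left mult.assoc)
    then have "omega * hat u (a \<mu>) = c * hat u (a \<mu>)" if "l1 < \<mu>" "\<mu> \<le> l2" for \<mu>
      using high[OF that] by metis
    then have "(omega - c) * hat u (a \<mu>) = 0" if "l1 < \<mu>" "\<mu> \<le> l2" for \<mu>
      using that by (simp add: left_diff_distrib)
    moreover have "omega - c \<noteq> 0" using mult(2) omega_notin_F by auto
    ultimately have "hat u (a \<mu>) = 0" if "\<mu> \<le> l2" for \<mu>
      using low(1)[of \<mu>] that by (cases "\<mu> \<le> l1") auto
    then have "a (Suc l2) + 1 \<le> card {j. j < n \<and> u j \<noteq> 0}" by (intro bch_bound uv mult) auto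
    then show ?thesis using cm[of u] by auto
  next
    case indep
    let ?d = "a (Suc l1) + 1"
    have "?d \<le> card {j. j < n \<and> u j \<noteq> 0}"
      using l1_lt_l2 low by (intro bch_bound uv indep) auto
    moreover have "?d \<le> card {j. j < n \<and> v j - c * u j \<noteq> 0}" if c: "c \<in> F" for c
    proof (rule bch_bound)
      show "(\<lambda>x. v x - c * u x) \<in> Fvecs F n"
        using uv c by (simp add: Fvecs_def diff_mem mult_mem)
      show "(\<lambda>x. v x - c * u x) \<noteq> (\<lambda>x. 0)" using indep(2)[OF c] by (auto simp: fun_eq_iff)
    qed (use low l1_lt_l2 in \<open>auto simp: hat_diff\<close>)
    then have "(\<Sum>c\<in>F. ?d) \<le> (\<Sum>c\<in>F. card {j. j < n \<and> v j - c * u j \<noteq> 0})" by (rule sum_mono)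
    ultimately have "?d + q * ?d \<le> q * swt n z"
      using swt_average[OF uv] by (simp add: card_F zp)
    then show ?thesis by simp
  qed
qed

text \<open>The distance is an infimum over naturals, and bounding it from below requires a nonempty
  set of weights.\<close>

lemma symp_dual_S_not_subset: "\<exists>z. z \<in> symp_dual F n S \<and> z \<notin> S"
proof -
  \<comment> \<open>At the last coset \<open>S\<close> ties the parameters by the factor
    \<open>omega\<close>, while its dual compares their \<open>Q\<close>-th powers. The factor
    \<open>omega ^ Q\<close> satisfies the dual condition, as
    \<open>(omega ^ Q) ^ Q = omega\<close>, but differs from \<open>omega\<close>.\<close>
  let ?\<gamma> = "\<lambda>\<nu>. if \<nu> = l2 then 1 else 0" and ?\<delta> = "\<lambda>\<nu>. if \<nu> = l2 then omega ^ Q else 0"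
  let ?z = "pairv n (tsum ?\<gamma>) (tsum ?\<delta>)"
  have l2: "l2 \<noteq> 0" using l1_lt_l2 by simp
  have "(omega ^ Q) ^ Q = omega" by (simp add: Q_times_Q pow_qr flip: power_mult)
  then have "?z \<in> symp_dual F n S"
    unfolding symp_dual_S[OF tsum_Fvecs tsum_Fvecs] using l1_lt_l2 l2 by (auto simp: hat_tsum_low)
  moreover have "?z \<notin> S"
  proof
    assume "?z \<in> S"
    then obtain \<gamma> \<delta> where eq: "?z = pairv n (tsum \<gamma>) (tsum \<delta>)" and w: "\<delta> l2 = omega * \<gamma> l2"
      unfolding S_eq using l1_lt_l2 by auto
    have "tsum ?\<gamma> = tsum \<gamma>" "tsum ?\<delta> = tsum \<delta>" using pairv_Fvecs_eqD[OF eq tsum_Fvecs tsum_Fvecs] by auto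
    then have "?\<gamma> l2 = \<gamma> l2" "?\<delta> l2 = \<delta> l2" using tsum_eqD(1) l2 by blast+
    then show False using w omega by simp
  qed
  ultimately show ?thesis by blast
qed

lemma zero_in_S: "(\<lambda>x. 0) \<in> S"
  unfolding S_def steane_code_def by (rule zero_in_rowspace)

lemma ea_d_S:
  "min (a (Suc l2) + 1) (nat \<lceil>(real q + 1) / real q * real (a (Suc l1) + 1)\<rceil>) \<le> ea_d F n S"
  unfolding ea_d_def
proof (rule cInf_greatest)
  show "swt n ` (symp_dual F n S - S \<inter> symp_dual F n S) \<noteq> {}"
    using symp_dual_S_not_subset by blast
next
  fix w assume "w \<in> swt n ` (symp_dual F n S - S \<inter> symp_dual F n S)"
  \<comment> \<open>The zero word lies in \<open>S\<close>, so only nonzero words are left to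
    consider.\<close>
  then obtain z where w: "w = swt n z" and z: "z \<in> symp_dual F n S" "z \<noteq> (\<lambda>x. 0)"
    using zero_in_S by blast
  from swt_bound[OF z]
  show "min (a (Suc l2) + 1) (nat \<lceil>(real q + 1) / real q * real (a (Suc l1) + 1)\<rceil>) \<le> w"
  proof
    assume "(q + 1) * (a (Suc l1) + 1) \<le> q * swt n z"
    then have "real ((q + 1) * (a (Suc l1) + 1)) \<le> real (q * swt n z)" by (rule of_nat_mono)
    then have "(real q + 1) / real q * real (a (Suc l1) + 1) \<le> real w"
      using q_gt_1 by (simp add: w field_simps)
    then have "\<lceil>(real q + 1) / real q * real (a (Suc l1) + 1)\<rceil> \<le> int w"
      by (simp add: ceiling_le_iff)
    then show ?thesis by simp
  qed (simp add: w)
qed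

section \<open>The subfield subcode as a code of trace words\<close>

definition \<Delta> :: "nat set" where
  "\<Delta> = (\<Union>\<nu>\<le>l2. {a \<nu> * q ^ t mod n | t. True})"

lemma finite_Delta: "finite \<Delta>"
  by (rule finite_subset[of _ "{..<n}"]) (auto simp: \<Delta>_def n_pos)

lemma eval_code_sum:
  assumes "\<And>k. k \<in> K \<Longrightarrow> g k \<in> eval_code \<beta> n D"
  shows "(\<lambda>j. \<Sum>k\<in>K. g k j) \<in> eval_code \<beta> n D"
proof -
  have "\<forall>k\<in>K. \<exists>c. g k = (\<lambda>j. if j < n then (\<Sum>i\<in>D. c i * \<beta> j ^ i) else 0)"
    using assms by (auto simp: eval_code_def)
  then obtain c where c: "\<forall>k\<in>K. g k = (\<lambda>j. if j < n then (\<Sum>i\<in>D. c k i * \<beta> j ^ i) else 0)"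
    by metis
  have "(\<lambda>j. \<Sum>k\<in>K. g k j) = (\<lambda>j. if j < n then (\<Sum>i\<in>D. (\<Sum>k\<in>K. c k i) * \<beta> j ^ i) else 0)"
  proof
    fix j
    have "(\<Sum>k\<in>K. g k j) = (\<Sum>k\<in>K. if j < n then (\<Sum>i\<in>D. c k i * \<beta> j ^ i) else 0)"
      by (rule sum.cong) (use c in auto)
    also have "\<dots> = (if j < n then (\<Sum>i\<in>D. (\<Sum>k\<in>K. c k i) * \<beta> j ^ i) else 0)"
      by (auto simp: sum_distrib_right intro: sum.swap)
    finally show "(\<Sum>k\<in>K. g k j) = (if j < n then (\<Sum>i\<in>D. (\<Sum>k\<in>K. c k i) * \<beta> j ^ i) else 0)" .
  qed
  then show ?thesis unfolding eval_code_def by (intro CollectI exI)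
qed

text \<open>The conjugate summands of the trace are monomials whose exponents, reduced modulo
  \<open>n\<close>, run through the coset of \<open>a \<nu>\<close>.\<close>

lemma tvec_in_eval_code:
  assumes "\<nu> \<le> l2"
  shows "tvec \<nu> x \<in> eval_code \<beta> n \<Delta>"
proof -
  have mono: "(\<lambda>j. if j < n then c * \<beta> j ^ i else 0) \<in> eval_code \<beta> n \<Delta>" if "i \<in> \<Delta>" for c i
    unfolding eval_code_def
    by (intro CollectI exI[of _ "\<lambda>k. if k = i then c else 0"] ext)
      (use that finite_Delta in \<open>simp add: if_distrib[of "\<lambda>y. y * _"] cong: if_cong\<close>)
  have "tvec \<nu> x = (\<lambda>j. \<Sum>l<r. if j < n then x ^ (q ^ l) * \<beta> j ^ (a \<nu> * q ^ l mod n) else 0)"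
  proof
    fix j show "tvec \<nu> x j = (\<Sum>l<r. if j < n then x ^ (q ^ l) * \<beta> j ^ (a \<nu> * q ^ l mod n) else 0)"
      by (cases "j < n") (simp_all add: tvec_def tr_def pow_mod_n beta_nz power_mult_distrib power_mult)
  qed
  also have "\<dots> \<in> eval_code \<beta> n \<Delta>"
    by (rule eval_code_sum, rule mono) (use assms in \<open>auto simp: \<Delta>_def\<close>)
  finally show ?thesis .
qed

lemma tcode_sum:
  "(\<And>k. k \<in> K \<Longrightarrow> g k \<in> tcode I) \<Longrightarrow> (\<lambda>j. \<Sum>k\<in>K. g k j) \<in> tcode I"
proof (induction K rule: infinite_finite_induct)
  case (insert k K)
  obtain \<gamma> where \<gamma>: "supported I \<gamma>" "g k = tsum \<gamma>"
    using insert.prems[of k] by (auto simp: tcode_def)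
  have "(\<lambda>j. \<Sum>k\<in>K. g k j) \<in> tcode I" using insert by blast
  then obtain \<delta> where \<delta>: "supported I \<delta>" "(\<lambda>j. \<Sum>k\<in>K. g k j) = tsum \<delta>"
    by (auto simp: tcode_def)
  have "(\<lambda>j. \<Sum>k\<in>insert k K. g k j) = tsum (\<lambda>\<nu>. \<gamma> \<nu> + \<delta> \<nu>)" "supported I (\<lambda>\<nu>. \<gamma> \<nu> + \<delta> \<nu>)"
    using insert \<gamma> \<delta> fun_cong[OF \<delta>(2)] by (auto simp: tsum_add fun_eq_iff supported_def)
  then show ?case by (metis tcodeI)
qed (use tcodeI[of I "\<lambda>_. 0"] in \<open>auto simp: supported_def\<close>)

lemma tvec_in_tcode:
  assumes "\<nu> \<le> l2"
  shows "tvec \<nu> x \<in> tcode {..l2}"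
  unfolding tsum_single[OF assms, symmetric] using assms by (intro tcodeI) (auto simp: supported_def)

text \<open>Multiplying by an element of trace 1 and taking traces fixes every vector over \<open>F\<close>.\<close>

lemma subfield_subcode: "Fvecs F n \<inter> eval_code \<beta> n \<Delta> = tcode {..l2}"
proof (intro equalityI subsetI)
  fix v assume "v \<in> Fvecs F n \<inter> eval_code \<beta> n \<Delta>"
  then obtain c where vF: "v \<in> Fvecs F n"
    and v: "v = (\<lambda>j. if j < n then (\<Sum>i\<in>\<Delta>. c i * \<beta> j ^ i) else 0)"
    by (auto simp: eval_code_def)
  obtain t where t: "tr t = 1" using tr_surj[OF one_mem] by blast
  define g where "g i = (\<lambda>j. if j < n then tr (t * c i * \<beta> j ^ i) else 0)" for i
  have "v = (\<lambda>j. \<Sum>i\<in>\<Delta>. g i j)"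
  proof
    fix j show "v j = (\<Sum>i\<in>\<Delta>. g i j)"
    proof (cases "j < n")
      case True
      have "v j = v j * tr t" by (simp add: t)
      also have "\<dots> = tr (v j * t)" by (simp add: tr_scale Fvecs_mem[OF vF])
      also have "v j * t = (\<Sum>i\<in>\<Delta>. t * c i * \<beta> j ^ i)"
        using True by (simp add: v sum_distrib_right sum_distrib_left mult_ac)
      finally show ?thesis using True by (simp add: tr_sum g_def)
    qed (simp add: v g_def)
  qed
  also have "\<dots> \<in> tcode {..l2}"
  proof (rule tcode_sum)
    fix i assume "i \<in> \<Delta>"
    then obtain \<nu> k where nk: "\<nu> \<le> l2" "i = a \<nu> * q ^ k mod n" by (auto simp: \<Delta>_def)
    \<comment> \<open>The \<open>q ^ k\<close>-th root of \<open>t * c i\<close>: since the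
      \<open>q ^ (r * k)\<close>-th power is the identity, it is a Frobenius power. By
      \<open>tr_frob\<close> the monomial of exponent \<open>i\<close> then has the same trace as
      one at the representative.\<close>
    define y where "y = (t * c i) ^ (q ^ ((r - 1) * k))"
    have pow_rk: "x ^ (q ^ (r * k)) = x" for x :: 'a
      by (induction k) (simp_all add: pow_qr power_add power_mult)
    have "y ^ (q ^ k) = (t * c i) ^ (q ^ ((r - 1) * k + k))"
      by (simp add: y_def power_add flip: power_mult)
    also have "(r - 1) * k + k = r * k" using r_pos by (cases r) auto
    finally have y: "y ^ (q ^ k) = t * c i" using pow_rk by simp
    have "g i = tvec \<nu> y"
    proof
      fix j show "g i j = tvec \<nu> y j"
      proof (cases "j < n")
        case True
        have "t * c i * \<beta> j ^ i = (y * \<beta> j ^ a \<nu>) ^ (q ^ k)"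
          using True by (simp add: nk y pow_mod_n beta_nz power_mult_distrib power_mult)
        then show ?thesis using True by (simp add: g_def tvec_def tr_frob)
      qed (simp add: g_def tvec_def)
    qed
    then show "g i \<in> tcode {..l2}" using tvec_in_tcode[OF nk(1)] by simp
  qed
  finally show "v \<in> tcode {..l2}" .
next
  fix v assume "v \<in> tcode {..l2}"
  then obtain \<gamma> where v: "v = tsum \<gamma>" by (auto simp: tcode_def)
  show "v \<in> Fvecs F n \<inter> eval_code \<beta> n \<Delta>"
    unfolding v using tsum_Fvecs by (auto simp: tsum_def intro!: eval_code_sum tvec_in_eval_code)
qed

lemma steane_data_S:
  "steane_data F n (Fvecs F n \<inter> eval_code \<beta> n \<Delta>) rs ts (Amat (l2 - l1))"
proof -
  have "{..l1} \<union> {l1<..l2} = {..l2}" "{..l1} \<inter> {l1<..l2} = {}" using l1_lt_l2 by auto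
  then have "{(\<lambda>x. u x + v x) | u v. u \<in> rowspace F rs \<and> v \<in> rowspace F ts} = tcode {..l2}"
    unfolding rowspace_rs rowspace_ts by (simp add: tcode_add)
  moreover have "rowspace F rs \<inter> rowspace F ts = {\<lambda>x. 0}"
    using rs_ts_Int zero_in_rowspace by blast
  ultimately show ?thesis
    unfolding steane_data_def subfield_subcode
    using rs_Fvecs ts_Fvecs lin_indep_rs lin_indep_ts Amat_carrier Amat_mem Amat_invertible Amat_eigenvalue
    by (auto simp: ts_def)
qed

end

section \<open>Minimal representatives of cyclotomic cosets\<close>

lemma finite_min_reps: "finite (min_reps p s n)"
  by (rule finite_subset[of _ "{..<n}"]) (auto simp: min_reps_def)

lemma rep_mem: "i < card (min_reps p s n) \<Longrightarrow> rep p s n i \<in> min_reps p s n"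
  using nth_mem[of i "sorted_list_of_set (min_reps p s n)"] finite_min_reps[of p s n]
  by (simp add: rep_def)

lemma rep_less:
  assumes "i < j" "j < card (min_reps p s n)"
  shows "rep p s n i < rep p s n j"
  unfolding rep_def
  by (rule sorted_wrt_nth_less[OF strict_sorted_list_of_set]) (use assms in simp_all)

lemma rep_surj:
  assumes "x \<in> min_reps p s n"
  obtains i where "i < card (min_reps p s n)" "rep p s n i = x"
  using assms finite_min_reps[of p s n]
  by (metis in_set_conv_nth length_sorted_list_of_set rep_def set_sorted_list_of_set)

lemma rep_0:
  assumes "0 < n"
  shows "rep p s n 0 = 0"
proof -
  have "0 \<in> min_reps p s n" using assms by (auto simp: min_reps_def cyc_coset_def)
  then obtain i where i: "i < card (min_reps p s n)" "rep p s n i = 0" by (rule rep_surj)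
  then show ?thesis using rep_less[of 0 i p s n] by (cases "i = 0") auto
qed

text \<open>As \<open>q ^ r\<close> is 1 modulo \<open>n\<close>, the factor
  \<open>q ^ ((r - 1) * t)\<close> undoes \<open>q ^ t\<close> without negative exponents. Cosets
  are therefore equivalence classes.\<close>

lemma coset_inverse:
  fixes q n r :: nat
  assumes "[q ^ r = 1] (mod n)" "0 < r" "[y = x * q ^ t] (mod n)"
  shows "[x = y * q ^ ((r - 1) * t)] (mod n)"
proof -
  have "[y * q ^ ((r - 1) * t) = x * q ^ t * q ^ ((r - 1) * t)] (mod n)"
    using assms(3) by (rule cong_scalar_right)
  also have "x * q ^ t * q ^ ((r - 1) * t) = x * q ^ (t + (r - 1) * t)"
    by (simp add: power_add mult.assoc)
  also have "t + (r - 1) * t = r * t" using assms(2) by (cases r) auto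
  also have "[x * q ^ (r * t) = x * 1 ^ t] (mod n)"
    unfolding power_mult using assms(1) by (intro cong_mult cong_pow cong_refl)
  finally show ?thesis by (simp add: cong_sym_eq)
qed

text \<open>The representative is the least element of the coset of \<open>i\<close>; its minimality
  in its own coset holds because that coset lies in the coset of \<open>i\<close>. The bound by
  \<open>i\<close> is what later limits its index.\<close>

lemma coset_representative:
  fixes p s n r :: nat
  assumes pr: "[(p ^ s) ^ r = 1] (mod n)" "0 < r" and i: "i < n"
  obtains \<nu> t where "\<nu> < card (min_reps p s n)" "rep p s n \<nu> \<le> i" "i = rep p s n \<nu> * p ^ (t * s) mod n"
proof -
  have ps: "p ^ (t * s) = (p ^ s) ^ t" for t by (simp add: mult.commute flip: power_mult)
  define b where "b = (LEAST b. b \<in> cyc_coset p s n i)"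
  have i_mem: "i \<in> cyc_coset p s n i"
    using i by (auto simp: cyc_coset_def intro!: exI[of _ 0])
  have b_mem: "b \<in> cyc_coset p s n i" unfolding b_def by (rule LeastI[of _ i]) (rule i_mem)
  then obtain k where k: "b = i * (p ^ s) ^ k mod n" by (auto simp: cyc_coset_def ps)
  have "b \<in> min_reps p s n"
    unfolding min_reps_def
  proof (intro CollectI conjI ballI)
    show "b < n" using k i by simp
    fix c assume "c \<in> cyc_coset p s n b"
    then obtain l where "c = b * (p ^ s) ^ l mod n" by (auto simp: cyc_coset_def ps)
    then have "c = i * (p ^ s) ^ (k + l) mod n"
      by (simp add: k mod_mult_left_eq power_add mult.assoc)
    then have "c \<in> cyc_coset p s n i" by (auto simp: cyc_coset_def ps)
    then show "b \<le> c" unfolding b_def by (rule Least_le)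
  qed
  then obtain \<nu> where \<nu>: "\<nu> < card (min_reps p s n)" "rep p s n \<nu> = b" by (rule rep_surj)
  have "b \<le> i" unfolding b_def by (rule Least_le) (rule i_mem)
  moreover have "[i = b * (p ^ s) ^ ((r - 1) * k)] (mod n)"
    by (rule coset_inverse[OF pr]) (simp add: k cong_def)
  then have "i = b * p ^ (((r - 1) * k) * s) mod n"
    using i unfolding ps by (simp add: cong_def)
  ultimately show ?thesis using that \<nu> by blast
qed

text \<open>Each of the two lies in the coset of the other and is least in its own, so they are
  equal; strict monotonicity of \<open>rep\<close> then equates the indices.\<close>

lemma rep_coset_inj:
  fixes p s n r :: nat
  assumes pr: "[(p ^ s) ^ r = 1] (mod n)" "0 < r"
    and \<mu>: "\<mu> < card (min_reps p s n)" and \<nu>: "\<nu> < card (min_reps p s n)"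
    and eq: "[rep p s n \<nu> * p ^ (t * s) = rep p s n \<mu>] (mod n)"
  shows "\<mu> = \<nu>"
proof -
  have ps: "p ^ (t * s) = (p ^ s) ^ t" for t by (simp add: mult.commute flip: power_mult)
  have le: "x \<le> y" if "x \<in> min_reps p s n" "y \<in> min_reps p s n" "[y = x * (p ^ s) ^ t] (mod n)" for x y t
  proof -
    have "y = x * p ^ (t * s) mod n"
      using that(2,3) unfolding ps by (simp add: cong_def min_reps_def)
    then have "y \<in> cyc_coset p s n x" by (auto simp: cyc_coset_def)
    then show ?thesis using that(1) by (simp add: min_reps_def)
  qed
  have c: "[rep p s n \<mu> = rep p s n \<nu> * (p ^ s) ^ t] (mod n)"
    using eq unfolding ps by (rule cong_sym)
  have "rep p s n \<mu> = rep p s n \<nu>"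
    using le[OF rep_mem[OF \<nu>] rep_mem[OF \<mu>] c] le[OF rep_mem[OF \<mu>] rep_mem[OF \<nu>] coset_inverse[OF pr c]]
    by (rule antisym[rotated])
  then show ?thesis using rep_less[of \<mu> \<nu> p s n] rep_less[of \<nu> \<mu> p s n] \<mu> \<nu> by (cases \<mu> \<nu> rule: linorder_cases) auto
qed

theorem theorem3p8:
  fixes p m s l1 l2 :: nat and \<beta> :: "nat \<Rightarrow> 'a::{field,finite}"
  assumes "prime p" and "0 < m" and "0 < s" and "s dvd m" and "s \<noteq> m"
    and "even m" and "even (m div s)"
    and "card (UNIV :: 'a set) = p ^ m"
    and "bij_betw \<beta> {0..<p ^ m - 1} (UNIV - {0})"
    and "0 < l2" and "l2 < card (min_reps p s (p ^ m - 1)) - 1"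
    and "rep p s (p ^ m - 1) l2 = p ^ (m div 2) - 1"
    and "l1 < l2"
  shows "\<exists>rs ts A.
     steane_data (subfield_pow (p ^ s)) (p ^ m - 1)
       (Fvecs (subfield_pow (p ^ s)) (p ^ m - 1) \<inter> eval_code \<beta> (p ^ m - 1) (Delta p s (p ^ m - 1) l2))
       rs ts A \<and>
     (let F = subfield_pow (p ^ s); n = p ^ m - 1; S = steane_code F n rs ts A in
        ea_k F n S = int n - int (m div s) * int (l1 + l2) - 1 + int (m div (2 * s)) \<and>
        ea_c F n S = m div (2 * s) + 1 \<and>
        ea_d F n S \<ge> min (rep p s n (l2 + 1) + 1)
          (nat \<lceil>(real (p ^ s) + 1) / real (p ^ s) * real (rep p s n (l1 + 1) + 1)\<rceil>))"
proof -
  define r where "r = m div s"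
  have m: "m = s * r" using assms(4) by (simp add: r_def)
  have "even r" using assms(7) by (simp add: r_def)
  with assms(2) m have r: "0 < r" "even r" by simp_all
  then obtain k where k: "r = 2 * k" by blast
  have half: "m div 2 = s * (r div 2)" "m div (2 * s) = r div 2"
    using assms(3) by (simp_all add: m k mult.left_commute[of s])
  interpret ext: finite_ext p s r \<beta>
    by unfold_locales (use assms r in \<open>auto simp: m\<close>)
  have n: "p ^ m - 1 = ext.n" by (simp add: ext.n_def ext.qr_eq m)
  have pr: "[(p ^ s) ^ r = 1] (mod ext.n)"
    unfolding ext.q_def[symmetric] ext.qr_n cong_def by (metis mod_add_self1)
  define a where "a = rep p s ext.n"
  \<comment> \<open>The last index is one less than the number of representatives, so
    \<open>l2 + 1\<close> still points into the list and \<open>a (Suc l2)\<close> is a genuine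
    representative.\<close>
  have card: "l2 + 1 < card (min_reps p s ext.n)" using assms(11) unfolding n by simp
  interpret code: bch_code p s r \<beta> a l1 l2
  proof
    show "a 0 = 0" unfolding a_def by (rule rep_0[OF ext.n_pos])
    show "a l2 = p ^ (s * (r div 2)) - 1" using assms(12) unfolding a_def n half(1) .
    show "l1 < l2" by fact
    show "a \<mu> < a \<nu>" if "\<mu> < \<nu>" "\<nu> \<le> l2" for \<mu> \<nu>
      unfolding a_def using that card by (intro rep_less) auto
    show "\<mu> = \<nu>" if "\<mu> \<le> l2" "\<nu> \<le> l2" "[a \<nu> * p ^ (t * s) = a \<mu>] (mod p ^ (s * r) - 1)" for \<mu> \<nu> t
      using rep_coset_inj[OF pr r(1), of \<mu> \<nu> t] that card unfolding a_def n[unfolded m] by simp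
    show "\<exists>\<nu>\<le>l. \<exists>t. i = a \<nu> * p ^ (t * s) mod (p ^ (s * r) - 1)" if l: "l \<le> l2" and i: "i < a (Suc l)" for l i
    proof -
      have "a (Suc l) < ext.n"
        using rep_mem[of "Suc l" p s ext.n] l card by (simp add: a_def min_reps_def)
      then have "i < ext.n" using i by simp
      then obtain \<nu> t where \<nu>: "\<nu> < card (min_reps p s ext.n)" "a \<nu> \<le> i" "i = a \<nu> * p ^ (t * s) mod ext.n"
        using coset_representative[OF pr r(1)] unfolding a_def by metis
      \<comment> \<open>The representative of \<open>i\<close> is at most \<open>i\<close>, hence
        below \<open>a (Suc l)\<close>, and so comes earlier in the list.\<close>
      have "\<nu> \<le> l"
      proof (rule ccontr)
        assume "\<not> \<nu> \<le> l"
        then have "a (Suc l) \<le> a \<nu>"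
          using rep_less[of "Suc l" \<nu> p s ext.n] \<nu>(1) by (cases "Suc l = \<nu>") (auto simp: a_def)
        then show False using \<nu>(2) i by simp
      qed
      then show ?thesis using \<nu>(3) unfolding n[unfolded m] by blast
    qed
  qed
  have Delta: "Delta p s ext.n l2 = code.\<Delta>"
    unfolding Delta_def code.\<Delta>_def cyc_coset_def code.q_pow_p a_def[symmetric] ..
  have F: "subfield_pow (p ^ s) = ext.F" by (simp add: ext.F_def ext.q_def)
  show ?thesis
    unfolding n F Delta Let_def half(2) r_def[symmetric] a_def[symmetric]
    using code.steane_data_S code.ea_k_S code.ea_c_S code.ea_d_S
    unfolding code.S_def ext.q_def
    by (intro exI[of _ code.rs] exI[of _ code.ts] exI[of _ "code.Amat (l2 - l1)"]) simp
qed

end
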